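(* Assume that $m\ge2$ is fixed and that $n_1=\cdots=n_m=n$. Then there exist positive constants $c_L(m)>0$ and $c_U(m)>0$, depending only on $m$, such that (for all $d,n,n_0\ge1$ and $\tau>0$ with $d\tau^2/n_0\le1$) $$c_L(m)\Big\{\Big(\frac{n}{dn_0}\Big)\vee1\Big\}\;\le\;\mathfrak C^\star([0,1]^m)\;\le\;c_U(m)\Big\{\Big(\frac{n}{dn_0}\Big)\vee1\Big\}.$$
   Context: There are $m+1$ domains ($k=0$ target, $k=1,\dots,m$ sources), with parameters $\theta_0^\star,\dots,\theta_m^\star\in\mathbb R^d$, sample sizes $\boldsymbol n=(n_0,\dots,n_m)$ and local estimators $\widetilde\theta_0,\dots,\widetilde\theta_m$. A constant $C_\tau>0$ is fixed throughout and suppressed from notation. For $\boldsymbol h\in[0,1]^m$, $\mathcal P(\boldsymbol h,\boldsymbol n,\tau)$ is the set of joint distributions of $(\widetilde\theta_0,\dots,\widetilde\theta_m)$ such that the $\widetilde\theta_k$ are independent and there exist $\theta_0^\star,\dots,\theta_m^\star\in\mathbb R^d$ with $\|\theta_k^\star-\theta_0^\star\|_2\le h_k$ for $k=1,\dots,m$ and $\max_{\|a\|_2=1}P(a^\top(\widetilde\theta_k-\theta_k^\star)>t)\le C_\tau\exp(-n_kt^2/(2\tau^2))$ for all $t>0$ and $k=0,\dots,m$. Oracle rate: with $h_0:=0$, $\mathfrak R(\boldsymbol h,\boldsymbol n,\tau):=\min_{\{0\}\subset S\subset\{0,\dots,m\}}\{d\tau^2/\sum_{k\in S}n_k+\max_{k\in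 S}h_k^2\}$. For $\mathcal H\subset[0,1]^m$ and an estimator $\widehat\theta_0$ depending on $\{\widetilde\theta_k\}_{k=0}^m$, $\boldsymbol n$, $\tau$ but not on $\boldsymbol h$, the adaptation cost is $\mathfrak C(\widehat\theta_0,\mathcal H):=\sup_{\boldsymbol h\in\mathcal H}\dfrac{\sup_{P\in\mathcal P(\boldsymbol h,\boldsymbol n,\tau)}\mathbb E_P[\|\widehat\theta_0-\theta_0^\star\|_2^2]}{\mathfrak R(\boldsymbol h,\boldsymbol n,\tau)}$, and the intrinsic cost of adaptation is $\mathfrak C^\star(\mathcal H):=\inf_{\widehat\theta_0}\mathfrak C(\widehat\theta_0,\mathcal H)$ over all such estimators. $a\vee b=\max(a,b)$. *)

theory Defs
  imports "HOL-Probability.Probability"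
begin

text \<open>
  The dimension \<open>d\<close> has to be quantified after the constants of the main result, so it cannot be
  a type: \<open>\<real>\<^sup>d\<close> is the product space over \<open>{..<d}\<close>, whose points are the functions
  \<open>nat \<Rightarrow> real\<close> that are \<open>undefined\<close> outside \<open>{..<d}\<close>.
\<close>

definition euclid :: "nat \<Rightarrow> (nat \<Rightarrow> real) measure" where
  "euclid d = (\<Pi>\<^sub>M i\<in>{..<d}. borel)"

definition dist2 :: "nat \<Rightarrow> (nat \<Rightarrow> real) \<Rightarrow> (nat \<Rightarrow> real) \<Rightarrow> real" where
  "dist2 d x y = L2_set (\<lambda>i. x i - y i) {..<d}"

definition data_space :: "nat \<Rightarrow> nat \<Rightarrow> (nat \<Rightarrow> nat \<Rightarrow> real) measure" where
  "data_space m d = (\<Pi>\<^sub>M k\<in>{0..m}. euclid d)"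

definition bias_cube :: "nat \<Rightarrow> (nat \<Rightarrow> real) set" where
  "bias_cube m = {1..m} \<rightarrow>\<^sub>E {0..1}"

text \<open>
  \<open>C\<close> is the constant \<open>C\<^sub>\<tau>\<close> of the tail condition, \<open>N k\<close> the sample size of domain \<open>k\<close>.
  The local estimators are the coordinate maps of \<open>data_space m d\<close>, whose joint law is \<open>P\<close>.
\<close>

definition compatible ::
  "real \<Rightarrow> nat \<Rightarrow> nat \<Rightarrow> (nat \<Rightarrow> nat) \<Rightarrow> real \<Rightarrow> (nat \<Rightarrow> real)
    \<Rightarrow> (nat \<Rightarrow> nat \<Rightarrow> real) measure \<Rightarrow> (nat \<Rightarrow> nat \<Rightarrow> real) \<Rightarrow> bool" where
  "compatible C m d N \<tau> h P \<theta> \<longleftrightarrow>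
     \<theta> \<in> space (data_space m d) \<and>
     (\<forall>k\<in>{1..m}. dist2 d (\<theta> k) (\<theta> 0) \<le> h k) \<and>
     (\<forall>k\<in>{0..m}. \<forall>t>0. \<forall>a. L2_set a {..<d} = 1 \<longrightarrow>
        measure P {\<omega> \<in> space P. (\<Sum>i<d. a i * (\<omega> k i - \<theta> k i)) > t}
          \<le> C * exp (- (real (N k) * t\<^sup>2 / (2 * \<tau>\<^sup>2))))"

definition dist_class ::
  "real \<Rightarrow> nat \<Rightarrow> nat \<Rightarrow> (nat \<Rightarrow> nat) \<Rightarrow> real \<Rightarrow> (nat \<Rightarrow> real)
    \<Rightarrow> (nat \<Rightarrow> nat \<Rightarrow> real) measure set" where
  "dist_class C m d N \<tau> h =
     {P. prob_space P \<and> sets P = sets (data_space m d) \<and>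
         prob_space.indep_vars P (\<lambda>k. euclid d) (\<lambda>k \<omega>. \<omega> k) {0..m} \<and>
         (\<exists>\<theta>. compatible C m d N \<tau> h P \<theta>)}"

definition oracle_rate :: "nat \<Rightarrow> nat \<Rightarrow> (nat \<Rightarrow> nat) \<Rightarrow> real \<Rightarrow> (nat \<Rightarrow> real) \<Rightarrow> real" where
  "oracle_rate m d N \<tau> h =
     Min ((\<lambda>S. real d * \<tau>\<^sup>2 / (\<Sum>k\<in>S. real (N k)) + Max ((\<lambda>k. ((h(0 := 0)) k)\<^sup>2) ` S))
          ` {S. {0} \<subseteq> S \<and> S \<subseteq> {0..m}})"

text \<open>
  The tail condition does not determine the target parameter \<open>\<theta> 0\<close> from \<open>P\<close>
  (for \<open>C > 1\<close> it tolerates a bias), so the worst case includes all compatible parameters.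
\<close>

definition worst_risk ::
  "real \<Rightarrow> nat \<Rightarrow> nat \<Rightarrow> (nat \<Rightarrow> nat) \<Rightarrow> real
    \<Rightarrow> ((nat \<Rightarrow> nat \<Rightarrow> real) \<Rightarrow> nat \<Rightarrow> real) \<Rightarrow> (nat \<Rightarrow> real) \<Rightarrow> ennreal" where
  "worst_risk C m d N \<tau> est h =
     (SUP P \<in> dist_class C m d N \<tau> h. SUP \<theta> \<in> {\<theta>. compatible C m d N \<tau> h P \<theta>}.
        \<integral>\<^sup>+ \<omega>. ennreal ((dist2 d (est \<omega>) (\<theta> 0))\<^sup>2) \<partial>P)"

definition adaptation_cost ::
  "real \<Rightarrow> nat \<Rightarrow> nat \<Rightarrow> (nat \<Rightarrow> nat) \<Rightarrow> real
    \<Rightarrow> ((nat \<Rightarrow> nat \<Rightarrow> real) \<Rightarrow> nat \<Rightarrow> real) \<Rightarrow> (nat \<Rightarrow> real) set \<Rightarrow> ennreal" where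
  "adaptation_cost C m d N \<tau> est H =
     (SUP h \<in> H. worst_risk C m d N \<tau> est h / ennreal (oracle_rate m d N \<tau> h))"

text \<open>
  The infimum is taken for fixed \<open>N\<close> and \<open>\<tau>\<close>, outside the supremum over \<open>h\<close>: the estimator
  may depend on \<open>N\<close> and \<open>\<tau>\<close> but not on \<open>h\<close>.
\<close>

definition intrinsic_cost ::
  "real \<Rightarrow> nat \<Rightarrow> nat \<Rightarrow> (nat \<Rightarrow> nat) \<Rightarrow> real \<Rightarrow> (nat \<Rightarrow> real) set \<Rightarrow> ennreal" where
  "intrinsic_cost C m d N \<tau> H =
     (INF est \<in> measurable (data_space m d) (euclid d). adaptation_cost C m d N \<tau> est H)"

end

theory Submission
  imports Defs
begin

text \<open>
  Write \<open>v = \<tau>\<^sup>2 / n\<^sub>0\<close>. The target alone has accuracy \<open>d v\<close>, a source \<open>k\<close> alone has accuracy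
  \<open>d \<tau>\<^sup>2 / n + h\<^sub>k\<^sup>2\<close>, and up to a factor depending on \<open>m\<close> the oracle picks the best of these. Not
  knowing the biases costs an additional \<open>v\<close>, a one-dimensional estimation error of the target:
  finding the good source only requires to locate the target along the lines that join the
  sources. Relative to the source accuracy \<open>d \<tau>\<^sup>2 / n\<close> the additional cost is the factor
  \<open>n / (d n\<^sub>0)\<close>.

  Upper bound. The estimator takes the source nearest to the target's own estimate, and falls back
  to that estimate if the source is farther away than a multiple of \<open>sqrt (d v)\<close>. Selection is
  cheap by \<open>nearer_candidate_error\<close>: it is disturbed only by the target noise along the lines
  through pairs of sources, which are independent of that noise (\<open>independent_direction_moment\<close>).
  The fallback bounds the risk by a multiple of \<open>d v\<close>. It must not spoil the case of a good
  source, and this needs the part of \<open>\<parallel>Y\<parallel>\<^sup>2\<close> above \<open>16 d v\<close>, for the target noise \<open>Y\<close>, to have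
  expectation of order \<open>v\<close> without the factor \<open>d\<close>. Since the tail condition only controls one
  direction at a time, this concentration is obtained by averaging over Gaussian directions
  (\<open>exp_norm_square_moment\<close>, \<open>norm_tail_second_moment\<close>).

  Lower bound. With deterministic sources and a target whose noise is a product of biased coins,
  estimation of the sign of each coordinate of the target fails with positive probability. If all
  sources are useless, adding over the coordinates gives risk of order \<open>d v\<close>, which is the oracle
  rate (\<open>worst_risk_full_bias\<close>). If two sources differ by \<open>sqrt v\<close> and one of them is exact, the
  oracle achieves \<open>d \<tau>\<^sup>2 / (n\<^sub>0 + n)\<close>, but an adaptive estimator cannot tell which, and its risk is
  of order \<open>v\<close> (\<open>worst_risk_one_unbiased_source\<close>).
\<close>

section \<open>Gaussian integrals\<close>

lemma nn_integral_normal_density: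
  assumes "\<sigma> > 0"
  shows "(\<integral>\<^sup>+x. ennreal (normal_density \<mu> \<sigma> x) \<partial>lborel) = 1"
proof -
  interpret prob_space "density lborel (normal_density \<mu> \<sigma>)" by (rule prob_space_normal_density[OF assms])
  show ?thesis using emeasure_space_1 by (simp add: emeasure_density)
qed

abbreviation std_gauss :: "real measure" where
  "std_gauss \<equiv> density lborel (normal_density 0 1)"

lemma std_gauss_mgf: "(\<integral>\<^sup>+x. ennreal (exp (b * x)) \<partial>std_gauss) = ennreal (exp (b\<^sup>2 / 2))"
proof -
  have eq: "normal_density 0 1 x * exp (b * x) = exp (b\<^sup>2 / 2) * normal_density b 1 x" for x
    by (simp add: normal_density_def mult_exp_exp) (simp add: power2_eq_square field_simps)
  have "(\<integral>\<^sup>+x. ennreal (exp (b * x)) \<partial>std_gauss)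
      = (\<integral>\<^sup>+x. ennreal (exp (b\<^sup>2 / 2)) * ennreal (normal_density b 1 x) \<partial>lborel)"
    by (subst nn_integral_density) (auto simp: ennreal_mult[symmetric] eq)
  also have "\<dots> = ennreal (exp (b\<^sup>2 / 2))"
    by (subst nn_integral_cmult) (auto simp: nn_integral_normal_density)
  finally show ?thesis .
qed

lemma std_gauss_exp_square: "(\<integral>\<^sup>+x. ennreal (exp (x\<^sup>2 / 4)) \<partial>std_gauss) = ennreal (sqrt 2)"
proof -
  have eq: "normal_density 0 1 x * exp (x\<^sup>2 / 4) = sqrt 2 * normal_density 0 (sqrt 2) x" for x
    by (simp add: normal_density_def mult_exp_exp real_sqrt_mult) (simp add: field_simps)
  have "(\<integral>\<^sup>+x. ennreal (exp (x\<^sup>2 / 4)) \<partial>std_gauss)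
      = (\<integral>\<^sup>+x. ennreal (sqrt 2) * ennreal (normal_density 0 (sqrt 2) x) \<partial>lborel)"
    by (subst nn_integral_density) (auto simp: ennreal_mult[symmetric] eq)
  also have "\<dots> = ennreal (sqrt 2)"
    by (subst nn_integral_cmult) (auto simp: nn_integral_normal_density)
  finally show ?thesis .
qed

section \<open>Sub-Gaussian random vectors\<close>

text \<open>
  Splitting the range of \<open>V = W\<^sub>+\<^sup>2 / (4 v)\<close> into unit steps turns the tail bound into a geometric series:
  \<open>V > j + 1\<close> has probability at most \<open>C exp (- 2 (j + 1))\<close>, and there \<open>exp V\<close> costs a factor
  \<open>exp (j + 2)\<close> on the step up to \<open>j + 2\<close>. All later moment bounds are read off from this one.
\<close>
lemma (in prob_space) exp_square_moment_of_tail: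
  fixes W :: "'a \<Rightarrow> real"
  assumes W [measurable]: "random_variable borel W" and v: "v > 0" and C: "C \<ge> 0"
    and tail: "\<And>t. t > 0 \<Longrightarrow> prob {\<omega> \<in> space M. t < W \<omega>} \<le> C * exp (- (t\<^sup>2 / (2 * v)))"
  shows "(\<integral>\<^sup>+\<omega>. ennreal (exp ((max 0 (W \<omega>))\<^sup>2 / (4 * v))) \<partial>M) \<le> ennreal (3 + 2 * C)"
proof -
  define V where "V \<omega> = (max 0 (W \<omega>))\<^sup>2 / (4 * v)" for \<omega>
  have [measurable]: "random_variable borel V" unfolding V_def by measurable
  have level: "emeasure M {\<omega> \<in> space M. real (Suc j) < V \<omega>} \<le> ennreal (C * exp (- 2 * real (Suc j)))" for j
  proof -
    define t where "t = sqrt (4 * v * real (Suc j))"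
    have t: "t > 0" "t\<^sup>2 = 4 * v * real (Suc j)" using v by (simp_all add: t_def)
    have "t < W \<omega>" if "real (Suc j) < V \<omega>" for \<omega>
    proof -
      from that v have "4 * v * real (Suc j) < (max 0 (W \<omega>))\<^sup>2"
        by (simp add: V_def field_simps)
      then have "t < max 0 (W \<omega>)" using t by (metis power2_less_imp_less max.cobounded1)
      then show ?thesis using t by auto
    qed
    then have "prob {\<omega> \<in> space M. real (Suc j) < V \<omega>} \<le> prob {\<omega> \<in> space M. t < W \<omega>}"
      by (intro finite_measure_mono) auto
    also have "\<dots> \<le> C * exp (- (t\<^sup>2 / (2 * v)))" by (rule tail[OF t(1)])
    also have "- (t\<^sup>2 / (2 * v)) = - 2 * real (Suc j)" using v by (simp add: t field_simps)
    finally show ?thesis by (simp add: emeasure_eq_measure ennreal_leI)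
  qed
  have pw: "ennreal (exp (V \<omega>)) \<le> ennreal 3 +
      (\<Sum>j. ennreal (exp (real j + 2)) * indicator {\<omega> \<in> space M. real (Suc j) < V \<omega>} \<omega>)"
    if \<omega>: "\<omega> \<in> space M" for \<omega>
  proof (cases "V \<omega> \<le> 1")
    case True
    then have "exp (V \<omega>) \<le> exp 1" by simp
    also have "\<dots> \<le> 3" by (rule exp_le)
    finally have "ennreal (exp (V \<omega>)) \<le> ennreal 3" by (rule ennreal_leI)
    then show ?thesis by (rule add_increasing2[rotated]) simp
  next
    case False
    \<comment> \<open>\<open>V \<omega>\<close> lies in the step from \<open>j + 1\<close> (excluded) to \<open>j + 2\<close> (included).\<close>
    define j where "j = nat (\<lceil>V \<omega>\<rceil> - 2)"
    have j: "real (Suc j) < V \<omega>" "V \<omega> \<le> real j + 2" unfolding j_def using False by linarith+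
    define f where "f = (\<lambda>j. ennreal (exp (real j + 2)) * indicator {\<omega> \<in> space M. real (Suc j) < V \<omega>} \<omega>)"
    have "ennreal (exp (V \<omega>)) \<le> ennreal (exp (real j + 2))" using j by (intro ennreal_leI) simp
    also have "\<dots> = f j" using j \<omega> by (simp add: f_def)
    also have "\<dots> = sum f {j}" by simp
    also have "\<dots> \<le> (\<Sum>j. f j)" by (rule sum_le_suminf) auto
    finally show ?thesis unfolding f_def by (rule add_increasing[rotated]) simp
  qed
  have "(\<integral>\<^sup>+\<omega>. ennreal (exp (V \<omega>)) \<partial>M) \<le> (\<integral>\<^sup>+\<omega>. ennreal 3 +
      (\<Sum>j. ennreal (exp (real j + 2)) * indicator {\<omega> \<in> space M. real (Suc j) < V \<omega>} \<omega>) \<partial>M)"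
    by (intro nn_integral_mono pw)
  also have "\<dots> = ennreal 3 + (\<Sum>j. ennreal (exp (real j + 2)) * emeasure M {\<omega> \<in> space M. real (Suc j) < V \<omega>})"
    by (subst nn_integral_add) (auto simp: nn_integral_suminf nn_integral_cmult emeasure_space_1)
  also have "\<dots> \<le> ennreal 3 + (\<Sum>j. ennreal (C * exp (- 1) ^ j))"
  proof (intro add_left_mono suminf_le)
    fix j
    have "ennreal (exp (real j + 2)) * emeasure M {\<omega> \<in> space M. real (Suc j) < V \<omega>}
        \<le> ennreal (exp (real j + 2)) * ennreal (C * exp (- 2 * real (Suc j)))"
      by (intro mult_left_mono level) simp
    also have "\<dots> = ennreal (C * exp (- 1) ^ j)"
      using C by (simp add: ennreal_mult[symmetric] exp_of_nat_mult[symmetric] mult_exp_exp)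
    finally show "ennreal (exp (real j + 2)) * emeasure M {\<omega> \<in> space M. real (Suc j) < V \<omega>}
        \<le> ennreal (C * exp (- 1) ^ j)" .
  qed auto
  also have "(\<Sum>j. ennreal (C * exp (- 1) ^ j)) = ennreal (C * (1 / (1 - exp (- 1))))"
  proof -
    have "(\<lambda>j. C * exp (- 1) ^ j) sums (C * (1 / (1 - exp (- 1 :: real))))"
      by (intro sums_mult geometric_sums) simp
    then show ?thesis using C by (intro suminf_ennreal_eq) simp_all
  qed
  also have "ennreal 3 + \<dots> = ennreal (3 + C * (1 / (1 - exp (- 1))))"
    using C by (subst ennreal_plus) auto
  also have "\<dots> \<le> ennreal (3 + 2 * C)"
  proof -
    have "(2::real) \<le> exp 1" using exp_ge_add_one_self[of "1::real"] by simp
    then have "1 / (1 - exp (- 1 :: real)) \<le> 2" by (simp add: exp_minus field_simps)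
    then have "C * (1 / (1 - exp (- 1 :: real))) \<le> C * 2" using C by (intro mult_left_mono)
    then show ?thesis by (intro ennreal_leI) simp
  qed
  finally show ?thesis by (simp add: V_def)
qed

text \<open>
  The tail bound on every unit direction is the only information on \<open>Y\<close>; the coordinates may be
  dependent, and the mean need not vanish.
\<close>
locale subgaussian_vector = prob_space M for M :: "'a measure" +
  fixes Y :: "'a \<Rightarrow> nat \<Rightarrow> real" and d :: nat and v C :: real
  assumes coord [measurable]: "i < d \<Longrightarrow> random_variable borel (\<lambda>\<omega>. Y \<omega> i)"
    and v_pos: "v > 0" and C_nonneg: "C \<ge> 0"
    and tail: "t > 0 \<Longrightarrow> L2_set a {..<d} = 1 \<Longrightarrow>
      prob {\<omega> \<in> space M. t < (\<Sum>i<d. a i * Y \<omega> i)} \<le> C * exp (- (t\<^sup>2 / (2 * v)))"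
begin

lemma coord_lessThan [measurable (raw)]: "i \<in> {..<d} \<Longrightarrow> random_variable borel (\<lambda>\<omega>. Y \<omega> i)"
  by (simp add: coord)

lemma exp_moment_unit:
  assumes "L2_set a {..<d} = 1"
  shows "(\<integral>\<^sup>+\<omega>. ennreal (exp ((max 0 (\<Sum>i<d. a i * Y \<omega> i))\<^sup>2 / (4 * v))) \<partial>M) \<le> ennreal (3 + 2 * C)"
  by (rule exp_square_moment_of_tail) (use v_pos C_nonneg tail assms in auto)

text \<open>
  By homogeneity the direction may be taken to be a unit vector, and then
  \<open>r w \<le> v r\<^sup>2 + w\<^sub>+\<^sup>2 / (4 v)\<close> reduces the claim to the exponential square moment.
\<close>
lemma mgf_bound:
  "(\<integral>\<^sup>+\<omega>. ennreal (exp (\<Sum>i<d. a i * Y \<omega> i)) \<partial>M) \<le> ennreal ((3 + 2 * C) * exp (v * (\<Sum>i<d. (a i)\<^sup>2)))"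
proof (cases "L2_set a {..<d} = 0")
  case True
  then have a: "a i = 0" if "i < d" for i using that by (simp add: L2_set_eq_0_iff)
  then have "(\<integral>\<^sup>+\<omega>. ennreal (exp (\<Sum>i<d. a i * Y \<omega> i)) \<partial>M) = 1" by (simp add: emeasure_space_1)
  moreover have "1 \<le> ennreal (3 + 2 * C)" using C_nonneg by (subst ennreal_1[symmetric], intro ennreal_leI) simp
  ultimately show ?thesis using a by simp
next
  case False
  define r where "r = L2_set a {..<d}"
  have r: "r > 0" using False L2_set_nonneg[of a "{..<d}"] by (simp add: r_def less_le)
  have r2: "r\<^sup>2 = (\<Sum>i<d. (a i)\<^sup>2)" by (simp add: r_def L2_set_def sum_nonneg)
  define b where "b i = a i / r" for i
  have b: "L2_set b {..<d} = 1"
    using r L2_set_left_distrib[of "1/r" a "{..<d}"] by (simp add: b_def[abs_def] r_def)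
  have pw: "exp (\<Sum>i<d. a i * Y \<omega> i)
      \<le> exp (v * r\<^sup>2) * exp ((max 0 (\<Sum>i<d. b i * Y \<omega> i))\<^sup>2 / (4 * v))" for \<omega>
  proof -
    define w where "w = (\<Sum>i<d. b i * Y \<omega> i)"
    have "(\<Sum>i<d. a i * Y \<omega> i) = r * w"
      unfolding w_def b_def using r by (simp add: sum_distrib_left)
    also have "\<dots> \<le> r * max 0 w" using r by (intro mult_left_mono) auto
    also have "\<dots> \<le> v * r\<^sup>2 + (max 0 w)\<^sup>2 / (4 * v)"
    proof -
      have "0 \<le> (2 * v * r - max 0 w)\<^sup>2 / (4 * v)" using v_pos by simp
      also have "\<dots> = v * r\<^sup>2 + (max 0 w)\<^sup>2 / (4 * v) - r * max 0 w"
        using v_pos by (simp add: power2_eq_square field_simps)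
      finally show ?thesis by simp
    qed
    finally show ?thesis by (simp add: w_def mult_exp_exp)
  qed
  have "(\<integral>\<^sup>+\<omega>. ennreal (exp (\<Sum>i<d. a i * Y \<omega> i)) \<partial>M) \<le>
      (\<integral>\<^sup>+\<omega>. ennreal (exp (v * r\<^sup>2)) * ennreal (exp ((max 0 (\<Sum>i<d. b i * Y \<omega> i))\<^sup>2 / (4 * v))) \<partial>M)"
    by (intro nn_integral_mono) (simp add: ennreal_mult[symmetric] pw ennreal_leI)
  also have "\<dots> = ennreal (exp (v * r\<^sup>2)) *
      (\<integral>\<^sup>+\<omega>. ennreal (exp ((max 0 (\<Sum>i<d. b i * Y \<omega> i))\<^sup>2 / (4 * v))) \<partial>M)"
    by (rule nn_integral_cmult) measurable
  also have "\<dots> \<le> ennreal (exp (v * r\<^sup>2)) * ennreal (3 + 2 * C)"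
    by (intro mult_left_mono exp_moment_unit b) simp
  also have "\<dots> = ennreal ((3 + 2 * C) * exp (v * (\<Sum>i<d. (a i)\<^sup>2)))"
    using C_nonneg by (simp add: ennreal_mult[symmetric] r2 mult.commute del: ennreal_plus)
  finally show ?thesis .
qed

lemma second_moment:
  assumes a: "L2_set a {..<d} \<le> 1"
  shows "(\<integral>\<^sup>+\<omega>. ennreal ((\<Sum>i<d. a i * Y \<omega> i)\<^sup>2) \<partial>M) \<le> ennreal (8 * v * (3 + 2 * C))"
proof -
  let ?r = "L2_set a {..<d}"
  have unit: "(\<integral>\<^sup>+\<omega>. ennreal ((\<Sum>i<d. b i * Y \<omega> i)\<^sup>2) \<partial>M) \<le> ennreal (8 * v * (3 + 2 * C))"
    if b: "L2_set b {..<d} = 1" for b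
  proof -
    have b': "L2_set (\<lambda>i. - b i) {..<d} = 1" using b by (simp add: L2_set_def)
    have pw: "w\<^sup>2 \<le> 4 * v * (exp ((max 0 w)\<^sup>2 / (4 * v)) + exp ((max 0 (- w))\<^sup>2 / (4 * v)))" for w
    proof -
      have "w\<^sup>2 / (4 * v) \<le> exp (w\<^sup>2 / (4 * v))" using exp_ge_add_one_self[of "w\<^sup>2 / (4 * v)"] by linarith
      also have "\<dots> \<le> exp ((max 0 w)\<^sup>2 / (4 * v)) + exp ((max 0 (- w))\<^sup>2 / (4 * v))"
        by (cases "w \<ge> 0") (auto simp: max_def)
      finally show ?thesis using v_pos by (simp add: field_simps)
    qed
    have "(\<integral>\<^sup>+\<omega>. ennreal ((\<Sum>i<d. b i * Y \<omega> i)\<^sup>2) \<partial>M) \<le>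
      (\<integral>\<^sup>+\<omega>. ennreal (4 * v) * (ennreal (exp ((max 0 (\<Sum>i<d. b i * Y \<omega> i))\<^sup>2 / (4 * v)))
        + ennreal (exp ((max 0 (\<Sum>i<d. (- b i) * Y \<omega> i))\<^sup>2 / (4 * v)))) \<partial>M)"
      using v_pos pw
      by (intro nn_integral_mono) (simp add: sum_negf ennreal_mult[symmetric] ennreal_plus[symmetric] ennreal_leI del: ennreal_plus)
    also have "\<dots> = ennreal (4 * v) * ((\<integral>\<^sup>+\<omega>. ennreal (exp ((max 0 (\<Sum>i<d. b i * Y \<omega> i))\<^sup>2 / (4 * v))) \<partial>M)
        + (\<integral>\<^sup>+\<omega>. ennreal (exp ((max 0 (\<Sum>i<d. (- b i) * Y \<omega> i))\<^sup>2 / (4 * v))) \<partial>M))"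
      by (subst nn_integral_cmult, measurable, subst nn_integral_add, measurable)
    also have "\<dots> \<le> ennreal (4 * v) * (ennreal (3 + 2 * C) + ennreal (3 + 2 * C))"
      by (intro mult_left_mono add_mono exp_moment_unit b b') simp
    also have "\<dots> = ennreal (8 * v * (3 + 2 * C))"
      using v_pos C_nonneg by (simp add: ennreal_mult[symmetric] ennreal_plus[symmetric] algebra_simps del: ennreal_plus)
    finally show ?thesis .
  qed
  show ?thesis
  proof (cases "?r = 0")
    case True
    then have "a i = 0" if "i < d" for i using that by (simp add: L2_set_eq_0_iff)
    then show ?thesis by simp
  next
    case False
    then have r: "?r > 0" using L2_set_nonneg[of a "{..<d}"] by (simp add: less_le)
    have "L2_set (\<lambda>i. a i / ?r) {..<d} = 1"
      using r L2_set_left_distrib[of "1/?r" a "{..<d}"] by simp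
    note u = unit[OF this]
    have "(\<Sum>i<d. a i * y i)\<^sup>2 \<le> (\<Sum>i<d. a i / ?r * y i)\<^sup>2" for y
    proof -
      have "(\<Sum>i<d. a i * y i)\<^sup>2 = ?r\<^sup>2 * (\<Sum>i<d. a i / ?r * y i)\<^sup>2"
        using r by (simp add: power_mult_distrib[symmetric] sum_distrib_left)
      also have "\<dots> \<le> 1 * (\<Sum>i<d. a i / ?r * y i)\<^sup>2"
        using a r by (intro mult_right_mono) (auto simp: power_le_one)
      finally show ?thesis by simp
    qed
    then have "(\<integral>\<^sup>+\<omega>. ennreal ((\<Sum>i<d. a i * Y \<omega> i)\<^sup>2) \<partial>M) \<le> (\<integral>\<^sup>+\<omega>. ennreal ((\<Sum>i<d. a i / ?r * Y \<omega> i)\<^sup>2) \<partial>M)"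
      by (intro nn_integral_mono ennreal_leI)
    with u show ?thesis by (rule order_trans[rotated])
  qed
qed

lemma norm_second_moment:
  "(\<integral>\<^sup>+\<omega>. ennreal ((L2_set (Y \<omega>) {..<d})\<^sup>2) \<partial>M) \<le> ennreal (8 * real d * v * (3 + 2 * C))"
proof -
  have e: "(\<integral>\<^sup>+\<omega>. ennreal ((Y \<omega> j)\<^sup>2) \<partial>M) \<le> ennreal (8 * v * (3 + 2 * C))" if "j < d" for j
  proof -
    let ?e = "\<lambda>i. if i = j then 1 else 0 :: real"
    have "L2_set ?e {..<d} \<le> 1" using that by (simp add: L2_set_def if_distrib[of "\<lambda>x. x\<^sup>2"] cong: if_cong)
    from second_moment[OF this] show ?thesis using that by (simp add: if_distrib[of "\<lambda>x. x * _"] cong: if_cong)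
  qed
  have "(\<integral>\<^sup>+\<omega>. ennreal ((L2_set (Y \<omega>) {..<d})\<^sup>2) \<partial>M) = (\<integral>\<^sup>+\<omega>. (\<Sum>j<d. ennreal ((Y \<omega> j)\<^sup>2)) \<partial>M)"
    by (simp add: L2_set_def sum_nonneg sum_ennreal)
  also have "\<dots> = (\<Sum>j<d. \<integral>\<^sup>+\<omega>. ennreal ((Y \<omega> j)\<^sup>2) \<partial>M)" by (rule nn_integral_sum) measurable
  also have "\<dots> \<le> (\<Sum>j<d. ennreal (8 * v * (3 + 2 * C)))" by (intro sum_mono e) simp
  also have "\<dots> = ennreal (8 * real d * v * (3 + 2 * C))"
    using v_pos C_nonneg by (simp add: ennreal_of_nat_eq_real_of_nat ennreal_mult[symmetric] mult_ac)
  finally show ?thesis .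
qed

text \<open>
  The exponential moment of the squared norm grows only like \<open>c\<^sup>d\<close>, so that \<open>\<parallel>Y\<parallel>\<^sup>2\<close> exceeds a large
  multiple of \<open>d v\<close> with exponentially small probability in \<open>d\<close>. The coordinates are not independent,
  so the squared norm is linearised instead: for a standard Gaussian vector \<open>z\<close>,
  \<open>exp (l\<^sup>2 \<parallel>y\<parallel>\<^sup>2 / 2)\<close> is the average of \<open>exp (l z \<bullet> y)\<close>. After exchanging the integrals, the direction
  \<open>z\<close> is fixed and the moment generating function of \<open>z \<bullet> Y\<close> is available; the remaining Gaussian
  integral factorises.
\<close>
lemma exp_norm_square_moment:
  "(\<integral>\<^sup>+\<omega>. ennreal (exp ((L2_set (Y \<omega>) {..<d})\<^sup>2 / (8 * v))) \<partial>M) \<le> ennreal ((3 + 2 * C) * sqrt 2 ^ d)"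
proof -
  interpret g: prob_space std_gauss by (rule prob_space_normal_density) simp
  interpret gs: product_prob_space "\<lambda>_. std_gauss" "{..<d}" by unfold_locales
  let ?G = "\<Pi>\<^sub>M i\<in>{..<d}. std_gauss"
  interpret P: pair_prob_space M ?G by unfold_locales
  \<comment> \<open>With this scale the bound on the moment generating function becomes the integrable weight \<open>exp (\<parallel>z\<parallel>\<^sup>2 / 4)\<close>.\<close>
  define l where "l = 1 / (2 * sqrt v)"
  have l2: "l\<^sup>2 = 1 / (4 * v)" using v_pos by (simp add: l_def power_divide power_mult_distrib)
  have avg: "ennreal (exp ((L2_set (Y \<omega>) {..<d})\<^sup>2 / (8 * v)))
      = (\<integral>\<^sup>+z. ennreal (exp (\<Sum>i<d. l * z i * Y \<omega> i)) \<partial>?G)" for \<omega>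
  proof -
    have "(\<integral>\<^sup>+z. ennreal (exp (\<Sum>i<d. l * z i * Y \<omega> i)) \<partial>?G)
        = (\<integral>\<^sup>+z. (\<Prod>i<d. ennreal (exp ((l * Y \<omega> i) * z i))) \<partial>?G)"
      by (intro nn_integral_cong) (simp add: exp_sum prod_ennreal mult_ac)
    also have "\<dots> = (\<Prod>i<d. \<integral>\<^sup>+x. ennreal (exp ((l * Y \<omega> i) * x)) \<partial>std_gauss)"
      by (rule gs.product_nn_integral_prod) auto
    also have "\<dots> = (\<Prod>i<d. ennreal (exp ((l * Y \<omega> i)\<^sup>2 / 2)))" by (simp only: std_gauss_mgf)
    also have "\<dots> = ennreal (exp (\<Sum>i<d. (l * Y \<omega> i)\<^sup>2 / 2))" by (simp add: exp_sum prod_ennreal)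
    also have "(\<Sum>i<d. (l * Y \<omega> i)\<^sup>2 / 2) = (L2_set (Y \<omega>) {..<d})\<^sup>2 / (8 * v)"
      by (simp add: power_mult_distrib l2 L2_set_def sum_nonneg sum_divide_distrib)
    finally show ?thesis ..
  qed
  have "(\<integral>\<^sup>+\<omega>. ennreal (exp ((L2_set (Y \<omega>) {..<d})\<^sup>2 / (8 * v))) \<partial>M)
      = (\<integral>\<^sup>+z. (\<integral>\<^sup>+\<omega>. ennreal (exp (\<Sum>i<d. l * z i * Y \<omega> i)) \<partial>M) \<partial>?G)"
    unfolding avg by (rule P.Fubini'[symmetric]) measurable
  also have "\<dots> \<le> (\<integral>\<^sup>+z. ennreal (3 + 2 * C) * (\<Prod>i<d. ennreal (exp ((z i)\<^sup>2 / 4))) \<partial>?G)"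
  proof (rule nn_integral_mono)
    fix z
    have "(\<integral>\<^sup>+\<omega>. ennreal (exp (\<Sum>i<d. l * z i * Y \<omega> i)) \<partial>M)
        \<le> ennreal ((3 + 2 * C) * exp (v * (\<Sum>i<d. (l * z i)\<^sup>2)))" by (rule mgf_bound)
    also have "v * (\<Sum>i<d. (l * z i)\<^sup>2) = (\<Sum>i<d. (z i)\<^sup>2 / 4)"
      using v_pos by (simp add: power_mult_distrib l2 sum_distrib_left)
    also have "ennreal ((3 + 2 * C) * exp (\<Sum>i<d. (z i)\<^sup>2 / 4))
        = ennreal (3 + 2 * C) * (\<Prod>i<d. ennreal (exp ((z i)\<^sup>2 / 4)))"
      using C_nonneg by (simp add: exp_sum prod_ennreal ennreal_mult prod_nonneg del: ennreal_plus)
    finally show "(\<integral>\<^sup>+\<omega>. ennreal (exp (\<Sum>i<d. l * z i * Y \<omega> i)) \<partial>M)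
        \<le> ennreal (3 + 2 * C) * (\<Prod>i<d. ennreal (exp ((z i)\<^sup>2 / 4)))" .
  qed
  also have "\<dots> = ennreal (3 + 2 * C) * (\<integral>\<^sup>+z. (\<Prod>i<d. ennreal (exp ((z i)\<^sup>2 / 4))) \<partial>?G)"
    by (rule nn_integral_cmult) measurable
  also have "(\<integral>\<^sup>+z. (\<Prod>i<d. ennreal (exp ((z i)\<^sup>2 / 4))) \<partial>?G) = (\<Prod>i<d. ennreal (sqrt 2))"
    by (subst gs.product_nn_integral_prod) (simp_all only: std_gauss_exp_square, auto)
  also have "ennreal (3 + 2 * C) * (\<Prod>i<d. ennreal (sqrt 2)) = ennreal ((3 + 2 * C) * sqrt 2 ^ d)"
    using C_nonneg by (simp add: ennreal_mult ennreal_power del: ennreal_plus)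
  finally show ?thesis .
qed

text \<open>
  The right-hand side is free of \<open>d\<close>. This is where concentration is needed: beyond the
  level \<open>16 d v\<close> the weight \<open>exp (- d)\<close> gained from the exponential Markov inequality
  outweighs the factor \<open>(sqrt 2)\<^sup>d\<close> in the exponential moment.
\<close>
lemma norm_tail_second_moment:
  "(\<integral>\<^sup>+\<omega>. ennreal (if 16 * real d * v < (L2_set (Y \<omega>) {..<d})\<^sup>2 then (L2_set (Y \<omega>) {..<d})\<^sup>2 else 0) \<partial>M)
    \<le> ennreal (16 * v * (3 + 2 * C))"
proof -
  have pw: "(if 16 * real d * v < s then s else 0) \<le> 16 * v * exp (- real d) * exp (s / (8 * v))"
    (is "?l \<le> ?r") if "s \<ge> 0" for s
  proof (cases "16 * real d * v < s")
    case True
    define u where "u = s / (8 * v)"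
    have u: "s = 8 * v * u" "2 * real d < u" using True v_pos by (simp_all add: u_def field_simps)
    have "u / 2 \<le> exp (u / 2)" using exp_ge_add_one_self[of "u / 2"] by linarith
    also have "\<dots> \<le> exp (u - real d)" using u by simp
    finally have "16 * v * (u / 2) \<le> 16 * v * exp (u - real d)" using v_pos by (intro mult_left_mono) auto
    also have "\<dots> = 16 * v * exp (- real d) * exp u" by (simp add: exp_diff exp_minus field_simps)
    finally show ?thesis using True u v_pos by simp
  qed (use v_pos in auto)
  have "(\<integral>\<^sup>+\<omega>. ennreal (if 16 * real d * v < (L2_set (Y \<omega>) {..<d})\<^sup>2 then (L2_set (Y \<omega>) {..<d})\<^sup>2 else 0) \<partial>M)
    \<le> (\<integral>\<^sup>+\<omega>. ennreal (16 * v * exp (- real d)) * ennreal (exp ((L2_set (Y \<omega>) {..<d})\<^sup>2 / (8 * v))) \<partial>M)"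
    using v_pos by (intro nn_integral_mono) (simp only: ennreal_mult[symmetric] ennreal_leI pw zero_le_power2
      exp_ge_zero mult_nonneg_nonneg less_imp_le zero_le_numeral)
  also have "\<dots> = ennreal (16 * v * exp (- real d)) * (\<integral>\<^sup>+\<omega>. ennreal (exp ((L2_set (Y \<omega>) {..<d})\<^sup>2 / (8 * v))) \<partial>M)"
    by (rule nn_integral_cmult) (simp add: L2_set_def)
  also have "\<dots> \<le> ennreal (16 * v * exp (- real d)) * ennreal ((3 + 2 * C) * sqrt 2 ^ d)"
    by (intro mult_left_mono exp_norm_square_moment) simp
  also have "\<dots> = ennreal (16 * v * (3 + 2 * C) * (sqrt 2 * exp (- 1)) ^ d)"
    using v_pos C_nonneg
    by (simp add: ennreal_mult[symmetric] power_mult_distrib exp_of_nat_mult[symmetric] mult_ac del: ennreal_plus)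
  also have "\<dots> \<le> ennreal (16 * v * (3 + 2 * C) * 1)"
  proof (intro ennreal_leI mult_left_mono power_le_one)
    have "sqrt 2 \<le> 2" using real_sqrt_le_iff[of 2 4] by simp
    also have "(2::real) \<le> exp 1" using exp_ge_add_one_self[of "1::real"] by simp
    finally show "sqrt 2 * exp (- 1) \<le> 1" by (simp add: exp_minus field_simps)
  qed (use v_pos C_nonneg in auto)
  finally show ?thesis by simp
qed

end

section \<open>Choosing the source nearest to the target\<close>

lemma dist2_nonneg [simp]: "0 \<le> dist2 d x y"
  by (simp add: dist2_def)

lemma dist2_square: "(dist2 d x y)\<^sup>2 = (\<Sum>i<d. (x i - y i)\<^sup>2)"
  by (simp add: dist2_def L2_set_def sum_nonneg)

lemma dist2_sym: "dist2 d x y = dist2 d y x"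
  by (simp add: dist2_def L2_set_def power2_commute)

lemma dist2_triangle: "dist2 d x z \<le> dist2 d x y + dist2 d y z"
  using L2_set_triangle_ineq[of "\<lambda>i. x i - y i" "\<lambda>i. y i - z i" "{..<d}"] by (simp add: dist2_def)

text \<open>
  The default \<open>x / 0 = 0\<close> makes this the zero vector when the points coincide, and the vector then
  still has norm at most one.
\<close>
definition direction :: "nat \<Rightarrow> (nat \<Rightarrow> real) \<Rightarrow> (nat \<Rightarrow> real) \<Rightarrow> nat \<Rightarrow> real" where
  "direction d x y i = (x i - y i) / dist2 d x y"

lemma L2_set_direction_le_1: "L2_set (direction d x y) {..<d} \<le> 1"
proof -
  have "L2_set (direction d x y) {..<d} = dist2 d x y / dist2 d x y"
    using L2_set_left_distrib[of "1 / dist2 d x y" "\<lambda>i. x i - y i" "{..<d}"]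
    by (simp add: direction_def[abs_def] dist2_def)
  then show ?thesis by simp
qed

lemma dist2_mult_direction:
  "dist2 d x y * (\<Sum>i<d. direction d x y i * z i) = (\<Sum>i<d. (x i - y i) * z i)"
proof (cases "dist2 d x y = 0")
  case True
  then have "x i - y i = 0" if "i < d" for i
    using that L2_set_eq_0_iff[of "{..<d}" "\<lambda>i. x i - y i"] unfolding dist2_def by simp
  then show ?thesis by (simp add: True)
qed (simp add: sum_distrib_left direction_def)

text \<open>
  Choosing between two candidates by their distance to a noisy observation \<open>y = \<theta> + noise\<close> costs
  only the component of the noise along the line through the candidates, whatever the dimension.
  Expanding the squares around \<open>\<theta>\<close> cancels \<open>\<parallel>noise\<parallel>\<^sup>2\<close> and leaves \<open>A\<^sup>2 \<le> B\<^sup>2 + 2 (A + B) z\<close>, that is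
  \<open>(A - z)\<^sup>2 \<le> (B + z)\<^sup>2\<close>, for the two errors \<open>A\<close> and \<open>B\<close>.
\<close>
lemma nearer_candidate_error:
  assumes near: "dist2 d x y \<le> dist2 d x' y"
    and z: "\<bar>\<Sum>i<d. direction d x x' i * (y i - \<theta> i)\<bar> \<le> z"
  shows "dist2 d x \<theta> \<le> dist2 d x' \<theta> + 2 * z"
proof (rule ccontr)
  let ?A = "dist2 d x \<theta>" and ?B = "dist2 d x' \<theta>"
  assume "\<not> ?thesis"
  then have lt: "?B + 2 * z < ?A" by simp
  have z0: "0 \<le> z" using z by linarith
  have expand: "(dist2 d w y)\<^sup>2 = (dist2 d w \<theta>)\<^sup>2 - 2 * (\<Sum>i<d. (w i - \<theta> i) * (y i - \<theta> i)) + (dist2 d y \<theta>)\<^sup>2" for w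
    unfolding dist2_square sum_distrib_left sum_subtractf[symmetric] sum.distrib[symmetric]
    by (intro sum.cong) (auto simp: power2_eq_square algebra_simps)
  have "(dist2 d x y)\<^sup>2 \<le> (dist2 d x' y)\<^sup>2" using near by (intro power_mono) auto
  then have "?A\<^sup>2 \<le> ?B\<^sup>2 + 2 * ((\<Sum>i<d. (x i - \<theta> i) * (y i - \<theta> i)) - (\<Sum>i<d. (x' i - \<theta> i) * (y i - \<theta> i)))"
    unfolding expand[of x] expand[of x'] by (simp add: algebra_simps)
  also have "(\<Sum>i<d. (x i - \<theta> i) * (y i - \<theta> i)) - (\<Sum>i<d. (x' i - \<theta> i) * (y i - \<theta> i))
      = (\<Sum>i<d. (x i - x' i) * (y i - \<theta> i))"
    by (simp add: sum_subtractf[symmetric] algebra_simps)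
  also have "\<dots> = dist2 d x x' * (\<Sum>i<d. direction d x x' i * (y i - \<theta> i))"
    by (rule dist2_mult_direction[symmetric])
  also have "\<dots> \<le> dist2 d x x' * z" using z by (intro mult_left_mono) auto
  also have "\<dots> \<le> (?A + ?B) * z"
    using z0 dist2_triangle[of d x x' \<theta>] by (intro mult_right_mono) (auto simp: dist2_sym[of d \<theta> x'])
  finally have "?A\<^sup>2 \<le> ?B\<^sup>2 + 2 * ((?A + ?B) * z)" by simp
  then have "(?A - z)\<^sup>2 \<le> (?B + z)\<^sup>2" by (simp add: power2_eq_square algebra_simps)
  then have "?A - z \<le> ?B + z" by (rule power2_le_imp_le) (use z0 in auto)
  with lt show False by simp
qed

text \<open>
  Ties go to the least index, which makes the selection a measurable function of the data.
\<close>
definition nearest_source :: "nat \<Rightarrow> nat \<Rightarrow> (nat \<Rightarrow> nat \<Rightarrow> real) \<Rightarrow> nat" where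
  "nearest_source m d \<omega> =
     (LEAST k. k \<in> {1..m} \<and> (\<forall>j\<in>{1..m}. dist2 d (\<omega> k) (\<omega> 0) \<le> dist2 d (\<omega> j) (\<omega> 0)))"

text \<open>
  The test with radius \<open>r\<close> keeps the risk of the order of the target's own accuracy when every
  source is badly biased.
\<close>
definition pretest_estimator :: "nat \<Rightarrow> nat \<Rightarrow> real \<Rightarrow> (nat \<Rightarrow> nat \<Rightarrow> real) \<Rightarrow> nat \<Rightarrow> real" where
  "pretest_estimator m d r \<omega> =
     (if dist2 d (\<omega> (nearest_source m d \<omega>)) (\<omega> 0) \<le> r then \<omega> (nearest_source m d \<omega>) else \<omega> 0)"

lemma nearest_source:
  assumes "m \<ge> 1"
  shows "nearest_source m d \<omega> \<in> {1..m}"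
    and "j \<in> {1..m} \<Longrightarrow> dist2 d (\<omega> (nearest_source m d \<omega>)) (\<omega> 0) \<le> dist2 d (\<omega> j) (\<omega> 0)"
proof -
  obtain k where "is_arg_min (\<lambda>k. dist2 d (\<omega> k) (\<omega> 0)) (\<lambda>k. k \<in> {1..m}) k"
    using ex_is_arg_min_if_finite[of "{1..m}"] assms by auto
  then have "k \<in> {1..m} \<and> (\<forall>j\<in>{1..m}. dist2 d (\<omega> k) (\<omega> 0) \<le> dist2 d (\<omega> j) (\<omega> 0))"
    by (auto simp: is_arg_min_linorder)
  from LeastI[of "\<lambda>k. k \<in> {1..m} \<and> (\<forall>j\<in>{1..m}. dist2 d (\<omega> k) (\<omega> 0) \<le> dist2 d (\<omega> j) (\<omega> 0))", OF this]
  show "nearest_source m d \<omega> \<in> {1..m}"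
    "j \<in> {1..m} \<Longrightarrow> dist2 d (\<omega> (nearest_source m d \<omega>)) (\<omega> 0) \<le> dist2 d (\<omega> j) (\<omega> 0)"
    unfolding nearest_source_def by blast+
qed

lemma measurable_estimator_component:
  "k \<in> {0..m} \<Longrightarrow> (\<lambda>\<omega>. \<omega> k) \<in> measurable (data_space m d) (euclid d)"
  unfolding data_space_def by (rule measurable_component_singleton)

lemma measurable_euclid_component:
  "i < d \<Longrightarrow> (\<lambda>x. x i) \<in> borel_measurable (euclid d)"
  unfolding euclid_def by (rule measurable_component_singleton) simp

lemma measurable_PiM_euclid_component:
  assumes "k \<in> I" "i \<in> {..<d}"
  shows "(\<lambda>z. z k i) \<in> borel_measurable (\<Pi>\<^sub>M k\<in>I. euclid d)"
  by (rule measurable_compose[of "\<lambda>z. z k" _ "euclid d" "\<lambda>x. x i"])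
    (use assms in \<open>auto intro: measurable_component_singleton measurable_euclid_component\<close>)

lemma borel_measurable_dist2:
  assumes "f \<in> measurable M (euclid d)" "g \<in> measurable M (euclid d)"
  shows "(\<lambda>x. dist2 d (f x) (g x)) \<in> borel_measurable M"
proof -
  have [measurable]: "(\<lambda>x. f x i) \<in> borel_measurable M" "(\<lambda>x. g x i) \<in> borel_measurable M" if "i \<in> {..<d}" for i
    using that assms by (auto intro: measurable_compose[OF _ measurable_euclid_component])
  show ?thesis unfolding dist2_def L2_set_def by measurable
qed

lemma measurable_pretest_estimator:
  assumes m: "m \<ge> 1"
  shows "pretest_estimator m d r \<in> measurable (data_space m d) (euclid d)"
proof -
  have P: "Measurable.pred (data_space m d) (\<lambda>\<omega>. k \<in> {1..m} \<and>
      (\<forall>j\<in>{1..m}. dist2 d (\<omega> k) (\<omega> 0) \<le> dist2 d (\<omega> j) (\<omega> 0)))" for k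
  proof (cases "k \<in> {1..m}")
    case True
    have "Measurable.pred (data_space m d) (\<lambda>\<omega>. dist2 d (\<omega> k) (\<omega> 0) \<le> dist2 d (\<omega> j) (\<omega> 0))"
      if "j \<in> {1..m}" for j
      unfolding pred_def using True that
      by (intro borel_measurable_le borel_measurable_dist2 measurable_estimator_component) auto
    then have "Measurable.pred (data_space m d)
        (\<lambda>\<omega>. \<forall>j\<in>{1..m}. dist2 d (\<omega> k) (\<omega> 0) \<le> dist2 d (\<omega> j) (\<omega> 0))"
      by (intro pred_intros_finite) auto
    then show ?thesis by (simp only: True simp_thms)
  next
    case False
    have "Measurable.pred (data_space m d) (\<lambda>\<omega>. False)" unfolding pred_def by simp
    then show ?thesis by (simp only: False simp_thms)
  qed
  have "nearest_source m d \<in> measurable (data_space m d) (count_space UNIV)"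
    unfolding nearest_source_def[abs_def] by (rule measurable_Least[OF P])
  then have sel: "nearest_source m d \<in> measurable (data_space m d) (count_space {1..m})"
    using nearest_source(1)[OF m] by (auto simp: measurable_def)
  have W: "(\<lambda>\<omega>. \<omega> (nearest_source m d \<omega>)) \<in> measurable (data_space m d) (euclid d)"
    by (rule measurable_compose_countable'[OF measurable_estimator_component sel]) auto
  have Z: "(\<lambda>\<omega>. \<omega> 0) \<in> measurable (data_space m d) (euclid d)"
    by (rule measurable_estimator_component) simp
  show ?thesis
    unfolding pretest_estimator_def[abs_def]
    by (rule measurable_If[OF W Z]) (intro borel_measurable_le borel_measurable_dist2 W Z borel_measurable_const)
qed

section \<open>Risk of the pretest estimator\<close>

lemma square_add_le: "(a + b)\<^sup>2 \<le> 2 * a\<^sup>2 + 2 * (b :: real)\<^sup>2"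
  using sum_squares_bound[of a b] by (simp add: power2_sum)

lemma ennreal_linear:
  assumes "0 \<le> x" "0 \<le> y" "0 \<le> z" "0 \<le> w"
  shows "ennreal (4 * x + y + 8 * z + w) = 4 * ennreal x + ennreal y + 8 * ennreal z + ennreal w"
  using assms by (simp add: ennreal_mult)

lemma (in prob_space) nn_integral_linear:
  assumes [measurable]: "F \<in> borel_measurable M" "G \<in> borel_measurable M" "H \<in> borel_measurable M"
  shows "(\<integral>\<^sup>+\<omega>. a * F \<omega> + c + b * G \<omega> + H \<omega> \<partial>M)
    = a * (\<integral>\<^sup>+\<omega>. F \<omega> \<partial>M) + c + b * (\<integral>\<^sup>+\<omega>. G \<omega> \<partial>M) + (\<integral>\<^sup>+\<omega>. H \<omega> \<partial>M)"
  by (simp add: nn_integral_add nn_integral_cmult emeasure_space_1)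

locale compatible_law = prob_space P for P :: "(nat \<Rightarrow> nat \<Rightarrow> real) measure" +
  fixes C :: real and m d :: nat and N :: "nat \<Rightarrow> nat" and \<tau> :: real
    and h :: "nat \<Rightarrow> real" and \<theta> :: "nat \<Rightarrow> nat \<Rightarrow> real"
  assumes sets_P: "sets P = sets (data_space m d)"
    and indep: "indep_vars (\<lambda>k. euclid d) (\<lambda>k \<omega>. \<omega> k) {0..m}"
    and compat: "compatible C m d N \<tau> h P \<theta>"
    and C_nonneg: "0 \<le> C" and \<tau>_pos: "0 < \<tau>"
    and N_pos: "k \<in> {0..m} \<Longrightarrow> 0 < N k" and m_pos: "0 < m"
begin

definition moment_const :: real where "moment_const = 3 + 2 * C"

lemma moment_const_ge_3: "3 \<le> moment_const"
  using C_nonneg by (simp add: moment_const_def)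

lemma measurable_P: "f \<in> measurable (data_space m d) L \<Longrightarrow> f \<in> measurable P L"
  by (simp add: measurable_cong_sets[OF sets_P refl])

lemma coord_measurable:
  "k \<in> {0..m} \<Longrightarrow> i \<in> {..<d} \<Longrightarrow> (\<lambda>\<omega>. \<omega> k i) \<in> borel_measurable P"
  by (rule measurable_P, unfold data_space_def, rule measurable_PiM_euclid_component)

lemma error_subgaussian:
  assumes k: "k \<in> {0..m}"
  shows "subgaussian_vector P (\<lambda>\<omega> i. \<omega> k i - \<theta> k i) d (\<tau>\<^sup>2 / real (N k)) C"
proof
  fix t :: real and a assume ta: "t > 0" "L2_set a {..<d} = 1"
  have eq: "- (real (N k) * t\<^sup>2 / (2 * \<tau>\<^sup>2)) = - (t\<^sup>2 / (2 * (\<tau>\<^sup>2 / real (N k))))"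
    using N_pos[OF k] by simp
  have "\<forall>k\<in>{0..m}. \<forall>t>0. \<forall>a. L2_set a {..<d} = 1 \<longrightarrow>
        prob {\<omega> \<in> space P. (\<Sum>i<d. a i * (\<omega> k i - \<theta> k i)) > t}
          \<le> C * exp (- (real (N k) * t\<^sup>2 / (2 * \<tau>\<^sup>2)))"
    using compat unfolding compatible_def by (elim conjE)
  from this[rule_format, OF k ta]
  show "prob {\<omega> \<in> space P. t < (\<Sum>i<d. a i * (\<omega> k i - \<theta> k i))}
      \<le> C * exp (- (t\<^sup>2 / (2 * (\<tau>\<^sup>2 / real (N k)))))"
    unfolding eq .
qed (use k N_pos \<tau>_pos C_nonneg coord_measurable in auto)

lemma norm_error:
  assumes k: "k \<in> {0..m}"
  shows "(\<integral>\<^sup>+\<omega>. ennreal ((dist2 d (\<omega> k) (\<theta> k))\<^sup>2) \<partial>P) \<le> ennreal (8 * real d * (\<tau>\<^sup>2 / real (N k)) * moment_const)"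
  using subgaussian_vector.norm_second_moment[OF error_subgaussian[OF k]] by (simp add: dist2_def moment_const_def)

lemma norm_tail:
  "(\<integral>\<^sup>+\<omega>. ennreal (if 16 * real d * (\<tau>\<^sup>2 / real (N 0)) < (dist2 d (\<omega> 0) (\<theta> 0))\<^sup>2
      then (dist2 d (\<omega> 0) (\<theta> 0))\<^sup>2 else 0) \<partial>P) \<le> ennreal (16 * (\<tau>\<^sup>2 / real (N 0)) * moment_const)"
  unfolding dist2_def moment_const_def by (rule subgaussian_vector.norm_tail_second_moment[OF error_subgaussian]) simp

text \<open>
  The direction may depend on all sources, but not on the target. Conditioning on the sources
  turns it into a fixed direction, for which the second moment is free of the dimension.
\<close>
lemma independent_direction_moment:
  assumes u: "\<And>i. i \<in> {..<d} \<Longrightarrow> (\<lambda>z. u z i) \<in> borel_measurable (\<Pi>\<^sub>M k\<in>{1..m}. euclid d)"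
    and u1: "\<And>z. L2_set (u z) {..<d} \<le> 1"
  shows "(\<integral>\<^sup>+\<omega>. ennreal ((\<Sum>i<d. u (restrict \<omega> {1..m}) i * (\<omega> 0 i - \<theta> 0 i))\<^sup>2) \<partial>P)
    \<le> ennreal (8 * (\<tau>\<^sup>2 / real (N 0)) * moment_const)"
proof -
  let ?S = "\<Pi>\<^sub>M k\<in>{0::nat}. euclid d" and ?T = "\<Pi>\<^sub>M k\<in>{1..m}. euclid d"
  let ?X = "\<lambda>\<omega>. restrict \<omega> {0::nat}" and ?Z = "\<lambda>\<omega>. restrict \<omega> {1..m}"
  let ?f = "\<lambda>x z. ennreal ((\<Sum>i<d. u z i * (x 0 i - \<theta> 0 i))\<^sup>2)"
  have "indep_var ?S ?X ?T ?Z"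
    using indep_var_restrict[OF indep, of "{0}" "{1..m}"] by simp
  then have X: "?X \<in> measurable P ?S" and Z: "?Z \<in> measurable P ?T"
    and prod: "distr P ?S ?X \<Otimes>\<^sub>M distr P ?T ?Z = distr P (?S \<Otimes>\<^sub>M ?T) (\<lambda>\<omega>. (?X \<omega>, ?Z \<omega>))"
    unfolding indep_var_distribution_eq by auto
  interpret X: prob_space "distr P ?S ?X" by (rule prob_space_distr) fact
  interpret Z: prob_space "distr P ?T ?Z" by (rule prob_space_distr) fact
  interpret XZ: pair_prob_space "distr P ?S ?X" "distr P ?T ?Z" ..
  have x: "(\<lambda>x. x 0 i) \<in> borel_measurable ?S" if "i \<in> {..<d}" for i
    using that by (intro measurable_PiM_euclid_component) auto
  have x': "(\<lambda>p. fst p 0 i) \<in> borel_measurable (?S \<Otimes>\<^sub>M ?T)" if "i \<in> {..<d}" for i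
    using measurable_compose[OF measurable_fst x[OF that]] .
  have u': "(\<lambda>p. u (snd p) i) \<in> borel_measurable (?S \<Otimes>\<^sub>M ?T)" if "i \<in> {..<d}" for i
    using measurable_compose[OF measurable_snd u[OF that]] .
  have f: "case_prod ?f \<in> borel_measurable (?S \<Otimes>\<^sub>M ?T)"
    unfolding case_prod_beta'
    by (intro measurable_compose[OF _ measurable_ennreal] borel_measurable_sum borel_measurable_power
        borel_measurable_times borel_measurable_diff x' u' borel_measurable_const)
  have fz: "(\<lambda>x. ?f x z) \<in> borel_measurable ?S" for z
    by (intro measurable_compose[OF _ measurable_ennreal] borel_measurable_sum borel_measurable_power
        borel_measurable_times borel_measurable_diff x borel_measurable_const)
  have f': "case_prod ?f \<in> borel_measurable (distr P ?S ?X \<Otimes>\<^sub>M distr P ?T ?Z)"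
    using f by (simp add: measurable_cong_sets[OF sets_pair_measure_cong[OF sets_distr sets_distr] refl])
  have "(\<integral>\<^sup>+\<omega>. ?f \<omega> (?Z \<omega>) \<partial>P) = (\<integral>\<^sup>+p. case_prod ?f p \<partial>distr P (?S \<Otimes>\<^sub>M ?T) (\<lambda>\<omega>. (?X \<omega>, ?Z \<omega>)))"
    by (subst nn_integral_distr) (use measurable_Pair[OF X Z] f in simp_all)
  also have "\<dots> = (\<integral>\<^sup>+z. (\<integral>\<^sup>+x. ?f x z \<partial>distr P ?S ?X) \<partial>distr P ?T ?Z)"
    unfolding prod[symmetric] using XZ.nn_integral_snd[OF f'] by simp
  also have "\<dots> \<le> (\<integral>\<^sup>+z. ennreal (8 * (\<tau>\<^sup>2 / real (N 0)) * moment_const) \<partial>distr P ?T ?Z)"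
  proof (rule nn_integral_mono)
    fix z assume "z \<in> space (distr P ?T ?Z)"
    have "(\<integral>\<^sup>+x. ?f x z \<partial>distr P ?S ?X) = (\<integral>\<^sup>+\<omega>. ?f \<omega> z \<partial>P)"
      by (subst nn_integral_distr) (use X fz in simp_all)
    also have "\<dots> \<le> ennreal (8 * (\<tau>\<^sup>2 / real (N 0)) * moment_const)"
      unfolding moment_const_def by (rule subgaussian_vector.second_moment[OF error_subgaussian u1]) simp
    finally show "(\<integral>\<^sup>+x. ?f x z \<partial>distr P ?S ?X) \<le> ennreal (8 * (\<tau>\<^sup>2 / real (N 0)) * moment_const)" .
  qed
  also have "\<dots> = ennreal (8 * (\<tau>\<^sup>2 / real (N 0)) * moment_const)" using Z.emeasure_space_1 by simp
  finally show ?thesis .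
qed

definition proj_noise :: "nat \<Rightarrow> (nat \<Rightarrow> nat \<Rightarrow> real) \<Rightarrow> real" where
  "proj_noise k \<omega> = (\<Sum>j\<in>{1..m}. (\<Sum>i<d. direction d (\<omega> j) (\<omega> k) i * (\<omega> 0 i - \<theta> 0 i))\<^sup>2)"

lemma borel_measurable_dist2_const:
  assumes "k \<in> {0..m}"
  shows "(\<lambda>\<omega>. dist2 d (\<omega> k) x) \<in> borel_measurable P"
proof -
  have "(\<lambda>\<omega>. \<Sum>i<d. (\<omega> k i - x i)\<^sup>2) \<in> borel_measurable P"
    by (intro borel_measurable_sum borel_measurable_power borel_measurable_diff
      coord_measurable borel_measurable_const assms)
  then show ?thesis unfolding dist2_def L2_set_def by measurable
qed

lemma measurable_direction:
  assumes "j \<in> {0..m}" "k \<in> {0..m}" "i \<in> {..<d}"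
  shows "(\<lambda>\<omega>. direction d (\<omega> j) (\<omega> k) i) \<in> borel_measurable P"
proof -
  have [measurable]: "(\<lambda>\<omega>. dist2 d (\<omega> j) (\<omega> k)) \<in> borel_measurable P"
    using assms by (intro borel_measurable_dist2 measurable_P measurable_estimator_component)
  show ?thesis unfolding direction_def using assms
    by (intro borel_measurable_divide borel_measurable_diff coord_measurable) auto
qed

lemma proj_noise_moment:
  assumes k: "k \<in> {1..m}"
  shows "(\<integral>\<^sup>+\<omega>. ennreal (proj_noise k \<omega>) \<partial>P) \<le> ennreal (8 * real m * (\<tau>\<^sup>2 / real (N 0)) * moment_const)"
proof -
  let ?T = "\<Pi>\<^sub>M k\<in>{1..m}. euclid d"
  have j: "(\<integral>\<^sup>+\<omega>. ennreal ((\<Sum>i<d. direction d (\<omega> j) (\<omega> k) i * (\<omega> 0 i - \<theta> 0 i))\<^sup>2) \<partial>P)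
      \<le> ennreal (8 * (\<tau>\<^sup>2 / real (N 0)) * moment_const)" if j: "j \<in> {1..m}" for j
  proof -
    have c: "(\<lambda>z. z l) \<in> measurable ?T (euclid d)" if "l \<in> {1..m}" for l
      using that by (rule measurable_component_singleton)
    have [measurable]: "(\<lambda>z. dist2 d (z j) (z k)) \<in> borel_measurable ?T"
      using j k by (intro borel_measurable_dist2 c)
    have "(\<lambda>z. direction d (z j) (z k) i) \<in> borel_measurable ?T" if "i \<in> {..<d}" for i
    proof -
      have [measurable]: "(\<lambda>z. z j i) \<in> borel_measurable ?T" "(\<lambda>z. z k i) \<in> borel_measurable ?T"
        using that j k by (auto intro!: measurable_PiM_euclid_component)
      show ?thesis unfolding direction_def by measurable
    qed
    from independent_direction_moment[of "\<lambda>z. direction d (z j) (z k)", OF this L2_set_direction_le_1]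
    show ?thesis using j k by simp
  qed
  have "(\<integral>\<^sup>+\<omega>. ennreal (proj_noise k \<omega>) \<partial>P)
      = (\<integral>\<^sup>+\<omega>. (\<Sum>j\<in>{1..m}. ennreal ((\<Sum>i<d. direction d (\<omega> j) (\<omega> k) i * (\<omega> 0 i - \<theta> 0 i))\<^sup>2)) \<partial>P)"
    by (simp add: proj_noise_def sum_ennreal)
  also have "\<dots> = (\<Sum>j\<in>{1..m}. \<integral>\<^sup>+\<omega>. ennreal ((\<Sum>i<d. direction d (\<omega> j) (\<omega> k) i * (\<omega> 0 i - \<theta> 0 i))\<^sup>2) \<partial>P)"
    by (intro nn_integral_sum measurable_compose[OF _ measurable_ennreal] borel_measurable_sum
        borel_measurable_power borel_measurable_times borel_measurable_diff coord_measurable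
        measurable_direction borel_measurable_const) (use k in auto)
  also have "\<dots> \<le> (\<Sum>j\<in>{1..m}. ennreal (8 * (\<tau>\<^sup>2 / real (N 0)) * moment_const))" by (intro sum_mono j)
  also have "\<dots> = ennreal (8 * real m * (\<tau>\<^sup>2 / real (N 0)) * moment_const)"
    using moment_const_ge_3 by (simp add: ennreal_of_nat_eq_real_of_nat ennreal_mult[symmetric] mult_ac)
  finally show ?thesis .
qed

text \<open>
  The squared radius \<open>64 d \<tau>\<^sup>2 / n\<^sub>0\<close> is four times the level beyond which the target noise has a
  second moment free of \<open>d\<close>. If the noise is below that level and the test rejects the
  chosen source, the triangle inequality shows that the target was the better choice.
\<close>
abbreviation est :: "(nat \<Rightarrow> nat \<Rightarrow> real) \<Rightarrow> nat \<Rightarrow> real" where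
  "est \<equiv> pretest_estimator m d (8 * sqrt (real d * (\<tau>\<^sup>2 / real (N 0))))"

text \<open>
  Whatever the biases are, the test keeps the estimate within its radius of the target's own estimate.
\<close>
lemma risk_le_target_rate:
  "(\<integral>\<^sup>+\<omega>. ennreal ((dist2 d (est \<omega>) (\<theta> 0))\<^sup>2) \<partial>P) \<le> ennreal (144 * moment_const * (real d * (\<tau>\<^sup>2 / real (N 0))))"
proof -
  define e where "e = real d * (\<tau>\<^sup>2 / real (N 0))"
  have e: "e \<ge> 0" by (simp add: e_def)
  have pw: "(dist2 d (est \<omega>) (\<theta> 0))\<^sup>2 \<le> 128 * e + 2 * (dist2 d (\<omega> 0) (\<theta> 0))\<^sup>2" for \<omega>
  proof -
    have "dist2 d (est \<omega>) (\<omega> 0) \<le> 8 * sqrt e"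
      by (auto simp: pretest_estimator_def e_def dist2_def L2_set_def)
    then have "dist2 d (est \<omega>) (\<theta> 0) \<le> 8 * sqrt e + dist2 d (\<omega> 0) (\<theta> 0)"
      using dist2_triangle[of d "est \<omega>" "\<theta> 0" "\<omega> 0"] by simp
    then have "(dist2 d (est \<omega>) (\<theta> 0))\<^sup>2 \<le> (8 * sqrt e + dist2 d (\<omega> 0) (\<theta> 0))\<^sup>2"
      by (intro power_mono) auto
    also have "\<dots> \<le> 2 * (8 * sqrt e)\<^sup>2 + 2 * (dist2 d (\<omega> 0) (\<theta> 0))\<^sup>2"
      by (rule square_add_le)
    finally show ?thesis using e by (simp add: power_mult_distrib)
  qed
  have [measurable]: "(\<lambda>\<omega>. dist2 d (\<omega> 0) (\<theta> 0)) \<in> borel_measurable P"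
    by (rule borel_measurable_dist2_const) simp
  have "(\<integral>\<^sup>+\<omega>. ennreal ((dist2 d (est \<omega>) (\<theta> 0))\<^sup>2) \<partial>P)
      \<le> (\<integral>\<^sup>+\<omega>. ennreal (128 * e) + 2 * ennreal ((dist2 d (\<omega> 0) (\<theta> 0))\<^sup>2) \<partial>P)"
  proof (rule nn_integral_mono)
    fix \<omega>
    have "ennreal ((dist2 d (est \<omega>) (\<theta> 0))\<^sup>2) \<le> ennreal (128 * e + 2 * (dist2 d (\<omega> 0) (\<theta> 0))\<^sup>2)"
      by (intro ennreal_leI pw)
    then show "ennreal ((dist2 d (est \<omega>) (\<theta> 0))\<^sup>2) \<le> ennreal (128 * e) + 2 * ennreal ((dist2 d (\<omega> 0) (\<theta> 0))\<^sup>2)"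
      using e by (simp add: ennreal_plus ennreal_mult)
  qed
  also have "\<dots> = ennreal (128 * e) + 2 * (\<integral>\<^sup>+\<omega>. ennreal ((dist2 d (\<omega> 0) (\<theta> 0))\<^sup>2) \<partial>P)"
    by (subst nn_integral_add) (auto simp: nn_integral_cmult emeasure_space_1)
  also have "\<dots> \<le> ennreal (128 * e) + 2 * ennreal (8 * real d * (\<tau>\<^sup>2 / real (N 0)) * moment_const)"
    by (intro add_left_mono mult_left_mono norm_error) auto
  also have "\<dots> = ennreal (128 * e + 2 * (8 * e * moment_const))"
  proof -
    have "8 * real d * (\<tau>\<^sup>2 / real (N 0)) * moment_const = 8 * e * moment_const" by (simp add: e_def)
    moreover have "ennreal (2 * (8 * e * moment_const)) = 2 * ennreal (8 * e * moment_const)"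
      by (subst ennreal_mult) (use e moment_const_ge_3 in auto)
    moreover have "ennreal (128 * e + 2 * (8 * e * moment_const)) = ennreal (128 * e) + ennreal (2 * (8 * e * moment_const))"
      by (rule ennreal_plus) (use e moment_const_ge_3 in auto)
    ultimately show ?thesis by (simp only:)
  qed
  also have "\<dots> \<le> ennreal (144 * moment_const * e)"
  proof (rule ennreal_leI)
    have "128 * e * 1 \<le> 128 * e * moment_const" using e moment_const_ge_3 by (intro mult_left_mono) auto
    then show "128 * e + 2 * (8 * e * moment_const) \<le> 144 * moment_const * e" by (simp add: algebra_simps)
  qed
  finally show ?thesis unfolding e_def .
qed

text \<open>
  The estimator is nearly as good as every single source \<open>k\<close>: its own noise and bias appear, and
  adaptation adds only the term of order \<open>\<tau>\<^sup>2 / n\<^sub>0\<close> without the factor \<open>d\<close>. That term pays for the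
  one-dimensional projections of the target noise that steer the selection, and for the rare
  event that large target noise makes the test reject a good source.
\<close>
lemma risk_le_source_rate:
  assumes k: "k \<in> {1..m}"
  shows "(\<integral>\<^sup>+\<omega>. ennreal ((dist2 d (est \<omega>) (\<theta> 0))\<^sup>2) \<partial>P)
    \<le> ennreal (moment_const * (32 * (real d * (\<tau>\<^sup>2 / real (N k))) + (64 * real m + 16) * (\<tau>\<^sup>2 / real (N 0))) + 4 * (h k)\<^sup>2)"
proof -
  define v0 where "v0 = \<tau>\<^sup>2 / real (N 0)"
  have v0: "v0 \<ge> 0" by (simp add: v0_def)
  let ?g = "\<lambda>\<omega>. if 16 * real d * v0 < (dist2 d (\<omega> 0) (\<theta> 0))\<^sup>2 then (dist2 d (\<omega> 0) (\<theta> 0))\<^sup>2 else 0"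
  have hk: "dist2 d (\<theta> k) (\<theta> 0) \<le> h k" using compat k by (auto simp: compatible_def)
  have pw: "(dist2 d (est \<omega>) (\<theta> 0))\<^sup>2
      \<le> 4 * (dist2 d (\<omega> k) (\<theta> k))\<^sup>2 + 4 * (h k)\<^sup>2 + 8 * proj_noise k \<omega> + ?g \<omega>" for \<omega>
  proof -
    define s where "s = nearest_source m d \<omega>"
    have s: "s \<in> {1..m}" "dist2 d (\<omega> s) (\<omega> 0) \<le> dist2 d (\<omega> k) (\<omega> 0)"
      using nearest_source[where m = m and d = d and \<omega> = \<omega>] m_pos k by (auto simp: s_def)
    define z where "z = sqrt (proj_noise k \<omega>)"
    have Z0: "proj_noise k \<omega> \<ge> 0" by (simp add: proj_noise_def sum_nonneg)
    have "\<bar>\<Sum>i<d. direction d (\<omega> s) (\<omega> k) i * (\<omega> 0 i - \<theta> 0 i)\<bar> \<le> z"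
      unfolding z_def proj_noise_def
      by (rule real_le_rsqrt, simp only: power2_abs, rule member_le_sum[OF s(1)]) auto
    from nearer_candidate_error[OF s(2) this]
    have A: "dist2 d (\<omega> s) (\<theta> 0) \<le> dist2 d (\<omega> k) (\<theta> k) + h k + 2 * z"
      using dist2_triangle[of d "\<omega> k" "\<theta> 0" "\<theta> k"] hk by simp
    have A2: "(dist2 d (\<omega> s) (\<theta> 0))\<^sup>2 \<le> 4 * (dist2 d (\<omega> k) (\<theta> k))\<^sup>2 + 4 * (h k)\<^sup>2 + 8 * proj_noise k \<omega>"
    proof -
      let ?b = "dist2 d (\<omega> k) (\<theta> k)"
      have "(dist2 d (\<omega> s) (\<theta> 0))\<^sup>2 \<le> (?b + h k + 2 * z)\<^sup>2" using A by (intro power_mono) auto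
      also have "\<dots> \<le> 4 * ?b\<^sup>2 + 4 * (h k)\<^sup>2 + 8 * z\<^sup>2"
        using zero_le_power2[of "?b + h k - 2 * z"] zero_le_power2[of "?b - h k"]
        by (simp add: power2_eq_square algebra_simps)
      also have "z\<^sup>2 = proj_noise k \<omega>" using Z0 by (simp add: z_def)
      finally show ?thesis .
    qed
    show ?thesis
    proof (cases "dist2 d (\<omega> s) (\<omega> 0) \<le> 8 * sqrt (real d * v0)")
      case True
      then have "est \<omega> = \<omega> s" by (simp add: pretest_estimator_def s_def v0_def)
      then show ?thesis using A2 by (simp add: add_increasing2)
    next
      case False
      then have est: "est \<omega> = \<omega> 0" by (simp add: pretest_estimator_def s_def v0_def)
      show ?thesis
      proof (cases "16 * real d * v0 < (dist2 d (\<omega> 0) (\<theta> 0))\<^sup>2")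
        case True
        then show ?thesis using Z0 unfolding est by simp
      next
        case small: False
        \<comment> \<open>The chosen source is farther than \<open>8 sqrt (d v)\<close> from the target's estimate, whose own error
          is at most half of this; so the parameter is nearer to that estimate than to the source.\<close>
        then have "dist2 d (\<omega> 0) (\<theta> 0) \<le> sqrt (16 * (real d * v0))" by (intro real_le_rsqrt) simp
        also have "\<dots> = 4 * sqrt (real d * v0)" by (simp only: real_sqrt_mult) simp
        finally have "dist2 d (\<omega> 0) (\<theta> 0) \<le> dist2 d (\<omega> s) (\<theta> 0)"
          using False dist2_triangle[of d "\<omega> s" "\<omega> 0" "\<theta> 0"] by (simp add: dist2_sym[of d "\<theta> 0"])
        then have "(dist2 d (\<omega> 0) (\<theta> 0))\<^sup>2 \<le> (dist2 d (\<omega> s) (\<theta> 0))\<^sup>2" by (intro power_mono) auto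
        from order_trans[OF this A2] show ?thesis using small unfolding est by simp
      qed
    qed
  qed
  have [measurable]: "(\<lambda>\<omega>. dist2 d (\<omega> 0) (\<theta> 0)) \<in> borel_measurable P"
      "(\<lambda>\<omega>. dist2 d (\<omega> k) (\<theta> k)) \<in> borel_measurable P"
    using k by (auto intro: borel_measurable_dist2_const)
  have [measurable]: "proj_noise k \<in> borel_measurable P"
    unfolding proj_noise_def[abs_def]
    by (intro borel_measurable_sum borel_measurable_power borel_measurable_times borel_measurable_diff
        coord_measurable measurable_direction borel_measurable_const) (use k in auto)
  have k0: "k \<in> {0..m}" using k by simp
  have "(\<integral>\<^sup>+\<omega>. ennreal ((dist2 d (est \<omega>) (\<theta> 0))\<^sup>2) \<partial>P)
      \<le> (\<integral>\<^sup>+\<omega>. 4 * ennreal ((dist2 d (\<omega> k) (\<theta> k))\<^sup>2) + ennreal (4 * (h k)\<^sup>2)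
          + 8 * ennreal (proj_noise k \<omega>) + ennreal (?g \<omega>) \<partial>P)"
  proof (rule nn_integral_mono)
    fix \<omega>
    have Z0: "proj_noise k \<omega> \<ge> 0" by (simp add: proj_noise_def sum_nonneg)
    have "ennreal ((dist2 d (est \<omega>) (\<theta> 0))\<^sup>2)
        \<le> ennreal (4 * (dist2 d (\<omega> k) (\<theta> k))\<^sup>2 + 4 * (h k)\<^sup>2 + 8 * proj_noise k \<omega> + ?g \<omega>)"
      by (intro ennreal_leI pw)
    also have "\<dots> = 4 * ennreal ((dist2 d (\<omega> k) (\<theta> k))\<^sup>2) + ennreal (4 * (h k)\<^sup>2)
          + 8 * ennreal (proj_noise k \<omega>) + ennreal (?g \<omega>)"
      by (rule ennreal_linear) (use Z0 in auto)
    finally show "ennreal ((dist2 d (est \<omega>) (\<theta> 0))\<^sup>2) \<le> \<dots>" .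
  qed
  also have "\<dots> = 4 * (\<integral>\<^sup>+\<omega>. ennreal ((dist2 d (\<omega> k) (\<theta> k))\<^sup>2) \<partial>P) + ennreal (4 * (h k)\<^sup>2)
      + 8 * (\<integral>\<^sup>+\<omega>. ennreal (proj_noise k \<omega>) \<partial>P) + (\<integral>\<^sup>+\<omega>. ennreal (?g \<omega>) \<partial>P)"
    by (rule nn_integral_linear) measurable
  also have "\<dots> \<le> 4 * ennreal (8 * real d * (\<tau>\<^sup>2 / real (N k)) * moment_const) + ennreal (4 * (h k)\<^sup>2)
      + 8 * ennreal (8 * real m * v0 * moment_const) + ennreal (16 * v0 * moment_const)"
    by (intro add_mono mult_left_mono order_refl norm_error[OF k0] proj_noise_moment[OF k, folded v0_def]
      norm_tail[folded v0_def]) auto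
  also have "\<dots> = ennreal (4 * (8 * real d * (\<tau>\<^sup>2 / real (N k)) * moment_const) + 4 * (h k)\<^sup>2
      + 8 * (8 * real m * v0 * moment_const) + 16 * v0 * moment_const)"
    by (rule ennreal_linear[symmetric]) (use v0 moment_const_ge_3 in auto)
  also have "4 * (8 * real d * (\<tau>\<^sup>2 / real (N k)) * moment_const) + 4 * (h k)\<^sup>2 + 8 * (8 * real m * v0 * moment_const) + 16 * v0 * moment_const
      = moment_const * (32 * (real d * (\<tau>\<^sup>2 / real (N k))) + (64 * real m + 16) * v0) + 4 * (h k)\<^sup>2"
    by (simp add: algebra_simps)
  finally show ?thesis unfolding v0_def .
qed

end

section \<open>The oracle rate and the upper bound\<close>

lemma oracle_rate_le:
  assumes "{0} \<subseteq> S" "S \<subseteq> {0..m}"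
  shows "oracle_rate m d N \<tau> h
    \<le> real d * \<tau>\<^sup>2 / (\<Sum>k\<in>S. real (N k)) + Max ((\<lambda>k. ((h(0 := 0)) k)\<^sup>2) ` S)"
  unfolding oracle_rate_def
  by (rule Min_le) (use assms in \<open>auto intro!: finite_imageI finite_subset[OF _ finite_Pow_iff[THEN iffD2, of "{0..m}"]]\<close>)

lemma oracle_rate_attained:
  obtains S where "{0} \<subseteq> S" "S \<subseteq> {0..m}"
    "oracle_rate m d N \<tau> h
      = real d * \<tau>\<^sup>2 / (\<Sum>k\<in>S. real (N k)) + Max ((\<lambda>k. ((h(0 := 0)) k)\<^sup>2) ` S)"
proof -
  have "finite {S. {0} \<subseteq> S \<and> S \<subseteq> {0..m}}"
    by (rule finite_subset[of _ "Pow {0..m}"]) auto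
  moreover have "{0} \<in> {S. {0} \<subseteq> S \<and> S \<subseteq> {0..m}}" by simp
  ultimately have "oracle_rate m d N \<tau> h \<in>
      (\<lambda>S. real d * \<tau>\<^sup>2 / (\<Sum>k\<in>S. real (N k)) + Max ((\<lambda>k. ((h(0 := 0)) k)\<^sup>2) ` S))
          ` {S. {0} \<subseteq> S \<and> S \<subseteq> {0..m}}"
    unfolding oracle_rate_def by (intro Min_in) blast+
  then show ?thesis using that by blast
qed

lemma le_Max_bias:
  fixes h :: "nat \<Rightarrow> real"
  assumes "S \<subseteq> {0..m}" "k \<in> S"
  shows "((h(0 := 0)) k)\<^sup>2 \<le> Max ((\<lambda>k. ((h(0 := 0)) k)\<^sup>2) ` S)"
  by (rule Max_ge) (use assms finite_subset[OF assms(1)] in auto)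

lemma oracle_rate_pos:
  assumes "0 < d" "0 < \<tau>" "\<And>k. k \<in> {0..m} \<Longrightarrow> 0 < N k"
  shows "0 < oracle_rate m d N \<tau> h"
proof -
  obtain S where S: "{0} \<subseteq> S" "S \<subseteq> {0..m}"
    and R: "oracle_rate m d N \<tau> h
      = real d * \<tau>\<^sup>2 / (\<Sum>k\<in>S. real (N k)) + Max ((\<lambda>k. ((h(0 := 0)) k)\<^sup>2) ` S)"
    by (rule oracle_rate_attained)
  have "0 < (\<Sum>k\<in>S. real (N k))"
    using S assms(3) finite_subset[OF S(2)] by (intro sum_pos) auto
  then have "0 < real d * \<tau>\<^sup>2 / (\<Sum>k\<in>S. real (N k))" using assms by simp
  moreover have "0 \<le> Max ((\<lambda>k. ((h(0 := 0)) k)\<^sup>2) ` S)"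
    using le_Max_bias[OF S(2), of 0 h] S(1) by simp
  ultimately show ?thesis unfolding R by linarith
qed

text \<open>
  If the oracle uses only the target, or if \<open>n\<close> is at most \<open>n\<^sub>0\<close>, then the target's own rate
  \<open>d \<tau>\<^sup>2 / n\<^sub>0\<close> is already optimal up to a factor \<open>m + 1\<close>. Otherwise the oracle set
  contains a source \<open>k\<close>, and the comparison with this source loses only \<open>\<tau>\<^sup>2 / n\<^sub>0\<close>, which is
  \<open>n / (d n\<^sub>0)\<close> times the source rate \<open>d \<tau>\<^sup>2 / n\<close>.
\<close>
lemma (in compatible_law) risk_le_oracle_rate:
  assumes d: "0 < d" and n: "\<forall>k\<in>{1..m}. N k = n"
  shows "(\<integral>\<^sup>+\<omega>. ennreal ((dist2 d (est \<omega>) (\<theta> 0))\<^sup>2) \<partial>P)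
    \<le> ennreal (144 * moment_const * (real m + 1)\<^sup>2 * max (real n / (real d * real (N 0))) 1 * oracle_rate m d N \<tau> h)"
proof -
  define R where "R = oracle_rate m d N \<tau> h"
  define q where "q = max (real n / (real d * real (N 0))) 1"
  obtain S where S: "{0} \<subseteq> S" "S \<subseteq> {0..m}"
    and R: "R = real d * \<tau>\<^sup>2 / (\<Sum>k\<in>S. real (N k)) + Max ((\<lambda>k. ((h(0 := 0)) k)\<^sup>2) ` S)"
    unfolding R_def by (rule oracle_rate_attained)
  have fS: "finite S" using finite_subset[OF S(2)] by simp
  define V where "V = (\<Sum>k\<in>S. real (N k))"
  define b where "b = Max ((\<lambda>k. ((h(0 := 0)) k)\<^sup>2) ` S)"
  have RV: "R = real d * \<tau>\<^sup>2 / V + b" by (simp add: R V_def b_def)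
  have b0: "0 \<le> b" using le_Max_bias[OF S(2), of 0 h] S(1) by (simp add: b_def)
  have N0: "0 < N 0" by (rule N_pos) simp
  have V0: "0 < V" unfolding V_def using S N_pos fS by (intro sum_pos) auto
  have R0: "0 \<le> R" using RV b0 V0 by simp
  have mc0: "0 \<le> moment_const" using moment_const_ge_3 by simp
  have q1: "1 \<le> q" by (simp add: q_def)
  have e: "real d * (\<tau>\<^sup>2 / a) \<le> (real m + 1) * R" if a: "0 < a" "V \<le> (real m + 1) * a" for a
  proof -
    have "real d * (\<tau>\<^sup>2 / a) = (real m + 1) * (real d * \<tau>\<^sup>2 / ((real m + 1) * a))" by simp
    also have "\<dots> \<le> (real m + 1) * (real d * \<tau>\<^sup>2 / V)"
      using a V0 by (intro mult_left_mono divide_left_mono mult_pos_pos) auto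
    also have "\<dots> \<le> (real m + 1) * R" using RV b0 by (intro mult_left_mono) auto
    finally show ?thesis .
  qed
  have Vsum: "V \<le> (real m + 1) * a" if "\<And>k. k \<in> S \<Longrightarrow> real (N k) \<le> a" "0 \<le> a" for a
  proof -
    have "V \<le> (\<Sum>k\<in>S. a)" unfolding V_def by (intro sum_mono that)
    also have "\<dots> = real (card S) * a" by simp
    also have "\<dots> \<le> (real m + 1) * a"
      using card_mono[OF _ S(2)] that(2) by (intro mult_right_mono) auto
    finally show ?thesis .
  qed
  show ?thesis
  proof (cases "n \<le> N 0 \<or> S = {0}")
    case True
    have "V \<le> (real m + 1) * real (N 0)"
    proof (rule Vsum)
      fix k assume "k \<in> S"
      then show "real (N k) \<le> real (N 0)" using True n S(2) by (cases "k = 0") auto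
    qed simp
    from e[OF _ this] N0 have "real d * (\<tau>\<^sup>2 / real (N 0)) \<le> (real m + 1) * R" by simp
    also have "\<dots> = (real m + 1) * 1 * 1 * R" by simp
    also have "\<dots> \<le> (real m + 1) * (real m + 1) * q * R"
      using R0 q1 by (intro mult_mono) auto
    finally have "144 * moment_const * (real d * (\<tau>\<^sup>2 / real (N 0))) \<le> 144 * moment_const * ((real m + 1) * (real m + 1) * q * R)"
      using mc0 by (intro mult_left_mono) auto
    also have "\<dots> = 144 * moment_const * (real m + 1)\<^sup>2 * q * R" by (simp add: power2_eq_square)
    finally have "ennreal (144 * moment_const * (real d * (\<tau>\<^sup>2 / real (N 0)))) \<le> ennreal (144 * moment_const * (real m + 1)\<^sup>2 * q * R)"
      by (rule ennreal_leI)
    with risk_le_target_rate show ?thesis unfolding q_def R_def by (rule order_trans)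
  next
    case False
    then obtain k where k: "k \<in> S" "k \<noteq> 0" using S(1) by auto
    then have km: "k \<in> {1..m}" using S(2) by auto
    then have Nk: "N k = n" "0 < n" using n N_pos[of k] by auto
    have "V \<le> (real m + 1) * real n"
    proof (rule Vsum)
      fix j assume "j \<in> S"
      then show "real (N j) \<le> real n" using False n S(2) by (cases "j = 0") auto
    qed simp
    from e[OF _ this] Nk have src: "real d * (\<tau>\<^sup>2 / real (N k)) \<le> (real m + 1) * R" by simp
    have hk: "(h k)\<^sup>2 \<le> R"
    proof -
      have "(h k)\<^sup>2 \<le> b" using le_Max_bias[OF S(2) k(1), of h] k(2) by (simp add: b_def)
      also have "b \<le> R" using V0 by (simp add: RV)
      finally show ?thesis .
    qed
    have tgt: "\<tau>\<^sup>2 / real (N 0) \<le> q * ((real m + 1) * R)"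
    proof -
      have "\<tau>\<^sup>2 / real (N 0) = real n / (real d * real (N 0)) * (real d * (\<tau>\<^sup>2 / real (N k)))"
        using Nk d N0 by (simp add: field_simps)
      also have "\<dots> \<le> q * (real d * (\<tau>\<^sup>2 / real (N k)))"
        by (intro mult_right_mono) (auto simp: q_def)
      also have "\<dots> \<le> q * ((real m + 1) * R)" using src q1 by (intro mult_left_mono) auto
      finally show ?thesis .
    qed
    define B where "B = q * ((real m + 1) * R)"
    have src': "real d * (\<tau>\<^sup>2 / real (N k)) \<le> B"
    proof -
      have "(real m + 1) * R \<le> B" using q1 R0 mult_right_mono[of 1 q "(real m + 1) * R"] by (simp add: B_def)
      with src show ?thesis by simp
    qed
    have hk': "(h k)\<^sup>2 \<le> B"
    proof -
      have "1 * (1 * R) \<le> B" unfolding B_def using q1 R0 by (intro mult_mono) auto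
      with hk show ?thesis by simp
    qed
    have B0: "0 \<le> B" using hk' zero_le_power2[of "h k"] by linarith
    have "moment_const * (32 * (real d * (\<tau>\<^sup>2 / real (N k))) + (64 * real m + 16) * (\<tau>\<^sup>2 / real (N 0))) + 4 * (h k)\<^sup>2
        \<le> moment_const * (32 * B + (64 * real m + 16) * B) + 4 * B"
      using src' tgt hk' mc0 unfolding B_def[symmetric]
      by (intro add_mono mult_left_mono) auto
    also have "\<dots> \<le> moment_const * (32 * B + (64 * real m + 16) * B) + moment_const * (4 * B)"
      using B0 moment_const_ge_3 mult_right_mono[of 1 moment_const "4 * B"] by auto
    also have "\<dots> = moment_const * ((64 * real m + 52) * B)" by (simp add: algebra_simps)
    also have "\<dots> \<le> moment_const * ((144 * (real m + 1)) * B)" using B0 mc0 by (intro mult_left_mono mult_right_mono) auto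
    also have "\<dots> = 144 * moment_const * (real m + 1)\<^sup>2 * q * R" by (simp add: B_def power2_eq_square)
    finally have "ennreal (moment_const * (32 * (real d * (\<tau>\<^sup>2 / real (N k))) + (64 * real m + 16) * (\<tau>\<^sup>2 / real (N 0))) + 4 * (h k)\<^sup>2)
      \<le> ennreal (144 * moment_const * (real m + 1)\<^sup>2 * q * R)" by (rule ennreal_leI)
    with risk_le_source_rate[OF km] show ?thesis unfolding q_def R_def by (rule order_trans)
  qed
qed

theorem intrinsic_cost_upper_bound:
  assumes m: "0 < m" and C: "0 \<le> C" and d: "0 < d" and \<tau>: "0 < \<tau>" and n0: "0 < N 0" and n: "0 < n"
    and N: "\<forall>k\<in>{1..m}. N k = n"
  shows "intrinsic_cost C m d N \<tau> H
    \<le> ennreal (144 * (3 + 2 * C) * (real m + 1)\<^sup>2 * max (real n / (real d * real (N 0))) 1)"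
proof -
  let ?est = "pretest_estimator m d (8 * sqrt (real d * (\<tau>\<^sup>2 / real (N 0))))"
  let ?K = "144 * (3 + 2 * C) * (real m + 1)\<^sup>2 * max (real n / (real d * real (N 0))) 1"
  have Npos: "0 < N k" if "k \<in> {0..m}" for k using that N n n0 by (cases "k = 0") auto
  have K: "0 \<le> ?K" using C by (intro mult_nonneg_nonneg) auto
  have risk: "worst_risk C m d N \<tau> ?est h \<le> ennreal (?K * oracle_rate m d N \<tau> h)" for h
    unfolding worst_risk_def
  proof (intro SUP_least)
    fix P \<theta> assume P: "P \<in> dist_class C m d N \<tau> h" and \<theta>: "\<theta> \<in> {\<theta>. compatible C m d N \<tau> h P \<theta>}"
    interpret prob_space P using P by (simp add: dist_class_def)
    interpret L: compatible_law P C m d N \<tau> h \<theta>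
      by unfold_locales (use P \<theta> C \<tau> m Npos in \<open>auto simp: dist_class_def\<close>)
    show "(\<integral>\<^sup>+\<omega>. ennreal ((dist2 d (?est \<omega>) (\<theta> 0))\<^sup>2) \<partial>P) \<le> ennreal (?K * oracle_rate m d N \<tau> h)"
      using L.risk_le_oracle_rate[OF d N] unfolding L.moment_const_def .
  qed
  have "adaptation_cost C m d N \<tau> ?est H \<le> ennreal ?K"
    unfolding adaptation_cost_def
  proof (rule SUP_least)
    fix h
    have R: "0 < oracle_rate m d N \<tau> h" by (rule oracle_rate_pos[OF d \<tau> Npos])
    have "worst_risk C m d N \<tau> ?est h / ennreal (oracle_rate m d N \<tau> h)
        \<le> ennreal (?K * oracle_rate m d N \<tau> h) / ennreal (oracle_rate m d N \<tau> h)"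
      by (rule divide_right_mono_ennreal[OF risk])
    also have "\<dots> = ennreal (?K * oracle_rate m d N \<tau> h / oracle_rate m d N \<tau> h)"
      by (rule divide_ennreal[OF mult_nonneg_nonneg[OF K less_imp_le[OF R]] R])
    also have "?K * oracle_rate m d N \<tau> h / oracle_rate m d N \<tau> h = ?K" using R by simp
    finally show "worst_risk C m d N \<tau> ?est h / ennreal (oracle_rate m d N \<tau> h) \<le> ennreal ?K" .
  qed
  moreover have "?est \<in> measurable (data_space m d) (euclid d)"
    by (rule measurable_pretest_estimator) (use m in simp)
  ultimately show ?thesis
    unfolding intrinsic_cost_def by (meson INF_lower2)
qed

section \<open>Least favourable target laws\<close>

text \<open>
  The corners of a cube serve as the mean vectors. Indexed by sets of coordinates, they can be averaged
  over \<open>Pow {..<d}\<close>, which flipping a coordinate permutes.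
\<close>
definition corner :: "nat \<Rightarrow> real \<Rightarrow> nat set \<Rightarrow> nat \<Rightarrow> real" where
  "corner d \<delta> T = (\<lambda>i\<in>{..<d}. if i \<in> T then \<delta> else - \<delta>)"

definition flip :: "nat \<Rightarrow> nat set \<Rightarrow> nat set" where
  "flip i T = (if i \<in> T then T - {i} else insert i T)"

lemma flip_flip [simp]: "flip i (flip i T) = T"
  by (auto simp: flip_def)

lemma mem_flip: "j \<in> flip i T \<longleftrightarrow> (if j = i then i \<notin> T else j \<in> T)"
  by (auto simp: flip_def)

text \<open>
  The mean is \<open>L / 2\<close> or \<open>- L / 2\<close>. The two laws have likelihood ratio at most \<open>3\<close>, and being
  supported in \<open>[- L, L]\<close> they are sub-Gaussian with variance factor \<open>L\<^sup>2\<close>.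
\<close>
definition coin :: "real \<Rightarrow> bool \<Rightarrow> real pmf" where
  "coin L b = map_pmf (\<lambda>s. if s then L else - L) (bernoulli_pmf (if b then 3 / 4 else 1 / 4))"

definition coins :: "nat \<Rightarrow> real \<Rightarrow> nat set \<Rightarrow> (nat \<Rightarrow> real) pmf" where
  "coins d L T = Pi_pmf {..<d} undefined (\<lambda>i. coin L (i \<in> T))"

text \<open>
  For \<open>C < 1 / 2\<close> the tail condition forces each coordinate of a local estimator to be exact with
  positive probability. The noise therefore occurs only with probability \<open>p\<close>, which scales the
  tails, and the lower bound for the risk, by \<open>p\<close>.
\<close>
definition contaminated :: "nat \<Rightarrow> real \<Rightarrow> real \<Rightarrow> nat set \<Rightarrow> (nat \<Rightarrow> real) pmf" where
  "contaminated d p L T =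
     bind_pmf (bernoulli_pmf p) (\<lambda>s. if s then coins d L T else return_pmf (corner d (L / 2) T))"

lemma pmf_coin_ratio:
  assumes L: "L > 0"
  shows "pmf (coin L b) x \<le> 3 * pmf (coin L b') x"
proof -
  have inj: "inj (\<lambda>s. if s then L else - L)" using L by (auto simp: inj_on_def split: if_splits)
  have T: "pmf (coin L b) L = (if b then 3 / 4 else 1 / 4)" for b
    using pmf_map_inj'[OF inj, of "bernoulli_pmf (if b then 3 / 4 else 1 / 4)" True] by (simp add: coin_def)
  have F: "pmf (coin L b) (- L) = (if b then 1 / 4 else 3 / 4)" for b
    using pmf_map_inj'[OF inj, of "bernoulli_pmf (if b then 3 / 4 else 1 / 4)" False] by (simp add: coin_def)
  consider "x = L" | "x = - L" | "x \<noteq> L" "x \<noteq> - L" by blast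
  then show ?thesis
  proof cases
    case 3
    then have "pmf (coin L b) x = 0" unfolding coin_def by (intro pmf_map_outside) auto
    then show ?thesis by simp
  qed (simp_all add: T F)
qed

lemma pmf_coins_ratio:
  assumes L: "L > 0" and i: "i < d"
  shows "pmf (coins d L T) x \<le> 3 * pmf (coins d L (flip i T)) x"
proof (cases "\<forall>j. j \<notin> {..<d} \<longrightarrow> x j = undefined")
  case True
  have split: "pmf (coins d L S) x = pmf (coin L (i \<in> S)) (x i) * (\<Prod>j\<in>{..<d} - {i}. pmf (coin L (j \<in> S)) (x j))" for S
  proof -
    have "pmf (coins d L S) x = (\<Prod>j\<in>{..<d}. pmf (coin L (j \<in> S)) (x j))"
      unfolding coins_def by (rule pmf_Pi') (use True in auto)
    also have "\<dots> = pmf (coin L (i \<in> S)) (x i) * (\<Prod>j\<in>{..<d} - {i}. pmf (coin L (j \<in> S)) (x j))"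
      by (rule prod.remove) (use i in auto)
    finally show ?thesis .
  qed
  have "(\<Prod>j\<in>{..<d} - {i}. pmf (coin L (j \<in> flip i T)) (x j)) = (\<Prod>j\<in>{..<d} - {i}. pmf (coin L (j \<in> T)) (x j))"
    by (rule prod.cong) (auto simp: mem_flip)
  then have "pmf (coins d L (flip i T)) x =
      pmf (coin L (i \<in> flip i T)) (x i) * (\<Prod>j\<in>{..<d} - {i}. pmf (coin L (j \<in> T)) (x j))"
    by (simp only: split)
  then show ?thesis
    using mult_right_mono[OF pmf_coin_ratio[OF L, of "i \<in> T" "x i" "i \<in> flip i T"],
        of "\<Prod>j\<in>{..<d} - {i}. pmf (coin L (j \<in> T)) (x j)"]
    by (simp add: split[of T] prod_nonneg mult.assoc)
next
  case False
  then have "pmf (coins d L T) x = 0" unfolding coins_def by (intro pmf_Pi_outside) auto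
  then show ?thesis by simp
qed

lemma nn_integral_coins_flip:
  assumes L: "L > 0" and i: "i < d"
  shows "(\<integral>\<^sup>+x. f x \<partial>coins d L T) \<le> 3 * (\<integral>\<^sup>+x. f x \<partial>coins d L (flip i T))"
proof -
  have "(\<integral>\<^sup>+x. f x \<partial>coins d L T) = (\<integral>\<^sup>+x. ennreal (pmf (coins d L T) x) * f x \<partial>count_space UNIV)"
    by (rule nn_integral_measure_pmf)
  also have "\<dots> \<le> (\<integral>\<^sup>+x. 3 * (ennreal (pmf (coins d L (flip i T)) x) * f x) \<partial>count_space UNIV)"
  proof (rule nn_integral_mono)
    fix x
    have "ennreal (pmf (coins d L T) x) \<le> ennreal (3 * pmf (coins d L (flip i T)) x)"
      by (intro ennreal_leI pmf_coins_ratio L i)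
    also have "\<dots> = 3 * ennreal (pmf (coins d L (flip i T)) x)" by (simp add: ennreal_mult)
    finally show "ennreal (pmf (coins d L T) x) * f x \<le> 3 * (ennreal (pmf (coins d L (flip i T)) x) * f x)"
      by (metis mult.assoc mult_right_mono zero_le)
  qed
  also have "\<dots> = 3 * (\<integral>\<^sup>+x. f x \<partial>coins d L (flip i T))"
    by (simp add: nn_integral_cmult nn_integral_measure_pmf)
  finally show ?thesis .
qed

text \<open>
  No function of the data can be close to both \<open>L / 2\<close> and \<open>- L / 2\<close>, and changing the sign of one
  coordinate changes the likelihood by a factor at most \<open>3\<close>. This is the two-point argument for a
  single coordinate.
\<close>
lemma coordinate_pair_risk:
  assumes L: "L > 0" and i: "i < d"
  shows "ennreal (L\<^sup>2 / 2) \<le>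
    3 * ((\<integral>\<^sup>+x. ennreal ((g x - corner d (L / 2) T i)\<^sup>2) \<partial>coins d L T)
      + (\<integral>\<^sup>+x. ennreal ((g x - corner d (L / 2) (flip i T) i)\<^sup>2) \<partial>coins d L (flip i T)))"
proof -
  let ?a = "corner d (L / 2) T i" and ?Q = "coins d L T"
  have a: "corner d (L / 2) (flip i T) i = - ?a" "?a\<^sup>2 = L\<^sup>2 / 4"
    using i by (auto simp: corner_def mem_flip power2_eq_square)
  have "ennreal (L\<^sup>2 / 2) = (\<integral>\<^sup>+x. ennreal (L\<^sup>2 / 2) \<partial>?Q)"
    by (simp add: measure_pmf.emeasure_space_1)
  also have "\<dots> \<le> (\<integral>\<^sup>+x. ennreal ((g x - ?a)\<^sup>2) + ennreal ((g x - - ?a)\<^sup>2) \<partial>?Q)"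
  proof (rule nn_integral_mono)
    fix x
    have "(g x - ?a)\<^sup>2 + (g x - - ?a)\<^sup>2 = 2 * (g x)\<^sup>2 + L\<^sup>2 / 2"
      using a(2) by (simp add: power2_eq_square algebra_simps)
    then have "L\<^sup>2 / 2 \<le> (g x - ?a)\<^sup>2 + (g x - - ?a)\<^sup>2" by simp
    then have "ennreal (L\<^sup>2 / 2) \<le> ennreal ((g x - ?a)\<^sup>2 + (g x - - ?a)\<^sup>2)" by (rule ennreal_leI)
    also have "\<dots> = ennreal ((g x - ?a)\<^sup>2) + ennreal ((g x - - ?a)\<^sup>2)" by (rule ennreal_plus) auto
    finally show "ennreal (L\<^sup>2 / 2) \<le> ennreal ((g x - ?a)\<^sup>2) + ennreal ((g x - - ?a)\<^sup>2)" .
  qed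
  also have "\<dots> = (\<integral>\<^sup>+x. ennreal ((g x - ?a)\<^sup>2) \<partial>?Q) + (\<integral>\<^sup>+x. ennreal ((g x - - ?a)\<^sup>2) \<partial>?Q)"
    by (rule nn_integral_add) auto
  also have "\<dots> \<le> 3 * (\<integral>\<^sup>+x. ennreal ((g x - ?a)\<^sup>2) \<partial>?Q) + 3 * (\<integral>\<^sup>+x. ennreal ((g x - - ?a)\<^sup>2) \<partial>coins d L (flip i T))"
  proof (rule add_mono[OF _ nn_integral_coins_flip[OF L i]])
    show "X \<le> 3 * X" for X :: ennreal
      using mult_right_mono[of 1 3 X] by simp
  qed
  finally show ?thesis by (simp only: a(1) distrib_left)
qed

lemma sum_flip:
  assumes "i < d"
  shows "(\<Sum>T\<in>Pow {..<d}. F (flip i T)) = (\<Sum>T\<in>Pow {..<d}. (F T :: ennreal))"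
  by (rule sum.reindex_bij_witness[of _ "flip i" "flip i"]) (use assms in \<open>auto simp: flip_def split: if_splits\<close>)

text \<open>
  Assouad's argument: the coordinatewise two-point bounds add up when the risk is averaged over all
  corners, because flipping coordinate \<open>i\<close> permutes the corners.
\<close>
lemma average_risk:
  assumes L: "L > 0"
  shows "ennreal (2 ^ d * (real d * L\<^sup>2 / 2))
    \<le> 6 * (\<Sum>T\<in>Pow {..<d}. \<integral>\<^sup>+x. ennreal ((dist2 d (g x) (corner d (L / 2) T))\<^sup>2) \<partial>coins d L T)"
proof -
  define r where "r i T = (\<integral>\<^sup>+x. ennreal ((g x i - corner d (L / 2) T i)\<^sup>2) \<partial>coins d L T)" for i T
  have coord: "ennreal (2 ^ d * (L\<^sup>2 / 2)) \<le> 6 * (\<Sum>T\<in>Pow {..<d}. r i T)" if i: "i < d" for i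
  proof -
    have "ennreal (2 ^ d * (L\<^sup>2 / 2)) = (\<Sum>T\<in>Pow {..<d}. ennreal (L\<^sup>2 / 2))"
      by (subst sum_ennreal) (auto simp: card_Pow)
    also have "\<dots> \<le> (\<Sum>T\<in>Pow {..<d}. 3 * (r i T + r i (flip i T)))"
      unfolding r_def by (intro sum_mono coordinate_pair_risk L i)
    also have "\<dots> = 3 * ((\<Sum>T\<in>Pow {..<d}. r i T) + (\<Sum>T\<in>Pow {..<d}. r i (flip i T)))"
      by (simp add: sum_distrib_left[symmetric] sum.distrib)
    also have "\<dots> = 6 * (\<Sum>T\<in>Pow {..<d}. r i T)"
      by (simp add: sum_flip[OF i] mult_2[symmetric] mult.assoc[symmetric])
    finally show ?thesis .
  qed
  have "ennreal (2 ^ d * (real d * L\<^sup>2 / 2)) = (\<Sum>i<d. ennreal (2 ^ d * (L\<^sup>2 / 2)))"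
    by (subst sum_ennreal) auto
  also have "\<dots> \<le> (\<Sum>i<d. 6 * (\<Sum>T\<in>Pow {..<d}. r i T))" by (intro sum_mono coord) auto
  also have "\<dots> = 6 * (\<Sum>T\<in>Pow {..<d}. \<Sum>i<d. r i T)"
    by (simp add: sum_distrib_left[symmetric] sum.swap[of _ "Pow {..<d}"])
  also have "(\<lambda>T. \<Sum>i<d. r i T) = (\<lambda>T. \<integral>\<^sup>+x. ennreal ((dist2 d (g x) (corner d (L / 2) T))\<^sup>2) \<partial>coins d L T)"
    unfolding r_def by (simp add: dist2_square nn_integral_sum[symmetric] sum_ennreal)
  finally show ?thesis .
qed

lemma coins_component: "i < d \<Longrightarrow> map_pmf (\<lambda>x. x i) (coins d L T) = coin L (i \<in> T)"
  by (simp add: coins_def Pi_pmf_component)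

text \<open>
  Along a unit vector \<open>a\<close> the coordinates contribute independent terms in intervals of length
  \<open>2 \<bar>a\<^sub>i\<bar> L\<close>, whose squares add up to \<open>4 L\<^sup>2\<close>, so Hoeffding's inequality applies.
\<close>
lemma coins_tail:
  assumes L: "L > 0" and t: "t > 0" and a: "L2_set a {..<d} = 1"
  shows "measure_pmf.prob (coins d L T) {x. t < (\<Sum>i<d. a i * (x i - corner d (L / 2) T i))}
    \<le> exp (- (t\<^sup>2 / (2 * L\<^sup>2)))"
proof -
  let ?Q = "measure_pmf (coins d L T)"
  define X where "X i x = a i * x i" for i and x :: "nat \<Rightarrow> real"
  define lo where "lo i = - (\<bar>a i\<bar> * L)" for i
  define hi where "hi i = \<bar>a i\<bar> * L" for i
  have supp: "AE x in ?Q. X i x \<in> {lo i..hi i}" if i: "i < d" for i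
  proof (rule AE_pmfI)
    fix x assume "x \<in> set_pmf (coins d L T)"
    then have "x i \<in> set_pmf (map_pmf (\<lambda>x. x i) (coins d L T))" by auto
    then have "x i = L \<or> x i = - L" unfolding coins_component[OF i] by (auto simp: coin_def)
    then have "\<bar>X i x\<bar> \<le> hi i" using L by (auto simp: X_def hi_def abs_mult)
    then show "X i x \<in> {lo i..hi i}" by (auto simp: lo_def hi_def)
  qed
  have ind: "prob_space.indep_vars ?Q (\<lambda>_. borel) X {..<d}"
    using prob_space.indep_vars_compose2[OF measure_pmf.prob_space_axioms
        indep_vars_Pi_pmf[of "{..<d}" undefined "\<lambda>i. coin L (i \<in> T)"], of "\<lambda>i y. a i * y" "\<lambda>_. borel"]
    unfolding X_def[abs_def] coins_def by simp
  interpret Hoeffding_ineq ?Q "{..<d}" X lo hi "\<Sum>i<d. measure_pmf.expectation (coins d L T) (X i)"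
    by unfold_locales (use ind supp in auto)
  have mean: "measure_pmf.expectation (coins d L T) (X i) = a i * corner d (L / 2) T i" if i: "i < d" for i
  proof -
    have "measure_pmf.expectation (coins d L T) (X i)
        = a i * measure_pmf.expectation (map_pmf (\<lambda>x. x i) (coins d L T)) (\<lambda>y. y)"
      by (simp add: X_def[abs_def])
    also have "measure_pmf.expectation (map_pmf (\<lambda>x. x i) (coins d L T)) (\<lambda>y. y) = corner d (L / 2) T i"
      using i by (simp add: coins_component coin_def corner_def)
    finally show ?thesis .
  qed
  have var: "(\<Sum>i<d. (hi i - lo i)\<^sup>2) = 4 * L\<^sup>2"
  proof -
    have "(\<Sum>i<d. (hi i - lo i)\<^sup>2) = (\<Sum>i<d. 4 * L\<^sup>2 * (a i)\<^sup>2)"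
      by (intro sum.cong) (auto simp: hi_def lo_def power_mult_distrib)
    also have "\<dots> = 4 * L\<^sup>2 * (\<Sum>i<d. (a i)\<^sup>2)" by (simp add: sum_distrib_left)
    also have "(\<Sum>i<d. (a i)\<^sup>2) = 1" using a by (simp add: L2_set_def)
    finally show ?thesis by simp
  qed
  have "measure_pmf.prob (coins d L T) {x. t < (\<Sum>i<d. a i * (x i - corner d (L / 2) T i))}
      \<le> measure_pmf.prob (coins d L T)
          {x \<in> space ?Q. (\<Sum>i<d. X i x) \<ge> (\<Sum>i<d. measure_pmf.expectation (coins d L T) (X i)) + t}"
    by (intro measure_pmf.finite_measure_mono)
      (auto simp: mean X_def right_diff_distrib sum_subtractf)
  also have "\<dots> \<le> exp (- 2 * t\<^sup>2 / (\<Sum>i<d. (hi i - lo i)\<^sup>2))"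
    by (rule Hoeffding_ineq_ge) (use t L var in auto)
  also have "- 2 * t\<^sup>2 / (\<Sum>i<d. (hi i - lo i)\<^sup>2) = - (t\<^sup>2 / (2 * L\<^sup>2))"
    unfolding var using L by (simp add: field_simps)
  finally show ?thesis .
qed

lemma contaminated_tail:
  assumes L: "L > 0" and p: "0 \<le> p" "p \<le> 1" and t: "t > 0" and a: "L2_set a {..<d} = 1"
  shows "measure_pmf.prob (contaminated d p L T) {x. t < (\<Sum>i<d. a i * (x i - corner d (L / 2) T i))}
    \<le> p * exp (- (t\<^sup>2 / (2 * L\<^sup>2)))"
proof -
  let ?A = "{x. t < (\<Sum>i<d. a i * (x i - corner d (L / 2) T i))}"
  have "emeasure (contaminated d p L T) ?A = emeasure (coins d L T) ?A * ennreal p"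
    using p t by (simp add: contaminated_def)
  also have "\<dots> = ennreal (measure_pmf.prob (coins d L T) ?A * p)"
    using p by (simp add: measure_pmf.emeasure_eq_measure ennreal_mult)
  finally have "measure_pmf.prob (contaminated d p L T) ?A = measure_pmf.prob (coins d L T) ?A * p"
    using p by (simp add: measure_def)
  also have "\<dots> \<le> exp (- (t\<^sup>2 / (2 * L\<^sup>2))) * p"
    by (intro mult_right_mono coins_tail L t a p)
  finally show ?thesis by (simp add: mult.commute)
qed

lemma contaminated_nn_integral_ge:
  assumes p: "0 \<le> p" "p \<le> 1"
  shows "ennreal p * (\<integral>\<^sup>+x. f x \<partial>coins d L T) \<le> (\<integral>\<^sup>+x. f x \<partial>contaminated d p L T)"
  using p by (simp add: contaminated_def mult.commute)

text \<open>
  Events of probability zero or one are independent of everything; this makes a random target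
  independent of deterministic sources.
\<close>
lemma (in prob_space) indep_sets_all_but_one_trivial:
  assumes ev: "\<And>i. i \<in> I \<Longrightarrow> F i \<subseteq> events"
    and triv: "\<And>i A. i \<in> I \<Longrightarrow> i \<noteq> l \<Longrightarrow> A \<in> F i \<Longrightarrow> prob A = 0 \<or> prob A = 1"
  shows "indep_sets F I"
  unfolding indep_sets_def
proof (intro conjI ballI allI impI)
  fix J A assume J: "J \<subseteq> I" "J \<noteq> {}" "finite J" and A: "A \<in> Pi J F"
  have evA: "A j \<in> events" if "j \<in> J" for j using that J A ev by (auto simp: Pi_iff)
  have evI: "(\<Inter>j\<in>J. A j) \<in> events" using J evA by (intro sets.finite_INT) auto
  show "prob (\<Inter>j\<in>J. A j) = (\<Prod>j\<in>J. prob (A j))"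
  proof (cases "\<exists>j\<in>J. prob (A j) = 0")
    case True
    then obtain j where j: "j \<in> J" "prob (A j) = 0" by auto
    have "prob (\<Inter>j\<in>J. A j) \<le> prob (A j)" using j evA by (intro finite_measure_mono) auto
    then have "prob (\<Inter>j\<in>J. A j) = 0" using j by (simp add: measure_le_0_iff)
    moreover have "(\<Prod>j\<in>J. prob (A j)) = 0" using j J(3) by (intro prod_zero) auto
    ultimately show ?thesis by simp
  next
    case False
    have one: "prob (A j) = 1" if "j \<in> J" "j \<noteq> l" for j
      using triv[of j "A j"] that J A False by (auto simp: Pi_iff)
    have "AE \<omega> in M. \<forall>j\<in>J - {l}. \<omega> \<in> A j"
      using J(3) one evA by (intro AE_finite_allI) (auto intro!: AE_prob_1)
    then have "AE \<omega> in M. \<omega> \<in> (\<Inter>j\<in>J. A j) \<longleftrightarrow> \<omega> \<in> (if l \<in> J then A l else space M)"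
      using AE_space by eventually_elim auto
    then have "prob (\<Inter>j\<in>J. A j) = prob (if l \<in> J then A l else space M)"
      by (rule finite_measure_eq_AE) (use evI evA in auto)
    also have "\<dots> = (\<Prod>j\<in>J. prob (A j))"
    proof (cases "l \<in> J")
      case True
      then show ?thesis using J(3) one by (subst prod.remove[of J l]) (auto intro!: prod.neutral)
    next
      case False
      then show ?thesis using one by (subst prod.neutral) (auto simp: prob_space)
    qed
    finally show ?thesis .
  qed
qed (use ev in auto)

section \<open>Lower bounds on the worst-case risk\<close>

text \<open>
  The sources are deterministic, so all the randomness comes from the target. The restriction makes the
  value a point of the data space for every argument, also off the support of a law.
\<close>
definition with_target :: "nat \<Rightarrow> nat \<Rightarrow> (nat \<Rightarrow> nat \<Rightarrow> real) \<Rightarrow> (nat \<Rightarrow> real) \<Rightarrow> nat \<Rightarrow> nat \<Rightarrow> real" where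
  "with_target m d s x = (\<lambda>k\<in>{0..m}. if k = 0 then restrict x {..<d} else s k)"

definition fixed_source_law ::
  "nat \<Rightarrow> nat \<Rightarrow> (nat \<Rightarrow> nat \<Rightarrow> real) \<Rightarrow> (nat \<Rightarrow> real) pmf \<Rightarrow> (nat \<Rightarrow> nat \<Rightarrow> real) measure" where
  "fixed_source_law m d s q = distr (measure_pmf q) (data_space m d) (with_target m d s)"

lemma space_euclid: "space (euclid d) = extensional {..<d}"
  by (simp add: euclid_def space_PiM PiE_def)

lemma space_data_space: "space (data_space m d) = {0..m} \<rightarrow>\<^sub>E extensional {..<d}"
  by (simp add: data_space_def space_PiM space_euclid)

lemma with_target_in_space:
  assumes "\<And>k. k \<in> {1..m} \<Longrightarrow> s k \<in> extensional {..<d}"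
  shows "with_target m d s x \<in> space (data_space m d)"
  using assms by (auto simp: with_target_def space_data_space PiE_iff extensional_def)

lemma measurable_with_target:
  assumes "\<And>k. k \<in> {1..m} \<Longrightarrow> s k \<in> extensional {..<d}"
  shows "with_target m d s \<in> measurable (measure_pmf q) (data_space m d)"
  using with_target_in_space[OF assms] by (simp add: Pi_iff)

lemma fixed_source_law_indep:
  assumes s: "\<And>k. k \<in> {1..m} \<Longrightarrow> s k \<in> extensional {..<d}"
  shows "prob_space.indep_vars (fixed_source_law m d s q) (\<lambda>k. euclid d) (\<lambda>k \<omega>. \<omega> k) {0..m}"
proof -
  let ?P = "fixed_source_law m d s q"
  interpret prob_space ?P
    unfolding fixed_source_law_def
    by (rule measure_pmf.prob_space_distr) (rule measurable_with_target[OF s])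
  have rv: "random_variable (euclid d) (\<lambda>\<omega>. \<omega> k)" if "k \<in> {0..m}" for k
    using measurable_estimator_component[OF that] by (simp add: fixed_source_law_def)
  show ?thesis
    unfolding indep_vars_def2
  proof (intro conjI ballI indep_sets_all_but_one_trivial[where l = 0])
    fix k B assume k: "k \<in> {0..m}" "k \<noteq> 0"
      and "B \<in> {(\<lambda>\<omega>. \<omega> k) -` A \<inter> space ?P |A. A \<in> sets (euclid d)}"
    then obtain A where A: "A \<in> sets (euclid d)" and B: "B = (\<lambda>\<omega>. \<omega> k) -` A \<inter> space ?P" by auto
    have "B \<in> sets (data_space m d)"
      using measurable_sets[OF rv[OF k(1)] A] by (simp add: B fixed_source_law_def)
    then have "prob B = measure_pmf.prob q (with_target m d s -` B)"
      unfolding fixed_source_law_def by (subst measure_distr[OF measurable_with_target[OF s]]) simp_all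
    also have "with_target m d s -` B = (if s k \<in> A then UNIV else {})"
      using k with_target_in_space[OF s] by (auto simp: B with_target_def fixed_source_law_def)
    finally show "prob B = 0 \<or> prob B = 1" by (auto split: if_splits)
  qed (use rv in \<open>auto dest: measurable_sets\<close>)
qed

lemma fixed_source_law_compatible:
  assumes s: "\<And>k. k \<in> {1..m} \<Longrightarrow> s k \<in> extensional {..<d}"
    and v: "v \<in> extensional {..<d}" and C: "0 \<le> C"
    and h: "\<And>k. k \<in> {1..m} \<Longrightarrow> dist2 d (s k) v \<le> h k"
    and tail: "\<And>t a. t > 0 \<Longrightarrow> L2_set a {..<d} = 1 \<Longrightarrow>
      measure_pmf.prob q {x. t < (\<Sum>i<d. a i * (x i - v i))} \<le> C * exp (- (real (N 0) * t\<^sup>2 / (2 * \<tau>\<^sup>2)))"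
  shows "compatible C m d N \<tau> h (fixed_source_law m d s q) (with_target m d s v)"
  unfolding compatible_def
proof (intro conjI ballI allI impI)
  let ?\<theta> = "with_target m d s v" and ?P = "fixed_source_law m d s q"
  show "?\<theta> \<in> space (data_space m d)" by (rule with_target_in_space[OF s])
  have \<theta>0: "?\<theta> 0 = v" using v by (simp add: with_target_def extensional_restrict)
  have \<theta>k: "?\<theta> k = s k" if "k \<in> {1..m}" for k using that by (simp add: with_target_def)
  show "dist2 d (?\<theta> k) (?\<theta> 0) \<le> h k" if "k \<in> {1..m}" for k
    unfolding \<theta>0 \<theta>k[OF that] by (rule h[OF that])
  fix k t a assume k: "k \<in> {0..m}" and t: "0 < (t :: real)" and a: "L2_set a {..<d} = 1"
  let ?A = "{\<omega> \<in> space (data_space m d). (\<Sum>i<d. a i * (\<omega> k i - ?\<theta> k i)) > t}"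
  have sp: "space ?P = space (data_space m d)" by (simp add: fixed_source_law_def)
  have "(\<lambda>\<omega>. \<Sum>i<d. a i * (\<omega> k i - ?\<theta> k i)) \<in> borel_measurable (data_space m d)"
    unfolding data_space_def
    by (intro borel_measurable_sum borel_measurable_times borel_measurable_diff
      borel_measurable_const measurable_PiM_euclid_component k)
  then have A: "?A \<in> sets (data_space m d)"
    by (intro borel_measurable_less borel_measurable_const)
  have "measure ?P ?A = measure_pmf.prob q (with_target m d s -` ?A)"
    unfolding fixed_source_law_def
    by (subst measure_distr[OF measurable_with_target[OF s] A]) simp_all
  also have "with_target m d s -` ?A = {x. t < (\<Sum>i<d. a i * (with_target m d s x k i - ?\<theta> k i))}"
    using with_target_in_space[OF s] by auto
  also have "measure_pmf.prob q \<dots> \<le> C * exp (- (real (N k) * t\<^sup>2 / (2 * \<tau>\<^sup>2)))"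
  proof (cases "k = 0")
    case True
    then show ?thesis using tail[OF t a] by (simp add: with_target_def)
  next
    case False
    then show ?thesis using k t C by (simp add: with_target_def)
  qed
  finally show "measure ?P {\<omega> \<in> space ?P. (\<Sum>i<d. a i * (\<omega> k i - ?\<theta> k i)) > t} \<le> C * exp (- (real (N k) * t\<^sup>2 / (2 * \<tau>\<^sup>2)))"
    unfolding sp .
qed

lemma corner_extensional: "corner d \<delta> T \<in> extensional {..<d}"
  by (simp add: corner_def)

text \<open>
  The sources \<open>s\<close> are the same for all corners \<open>T\<close>, so \<open>est\<close> composed with them is one fixed estimator
  of the corner from the target data alone.
\<close>
lemma worst_risk_ge_coins_risk:
  assumes est: "est \<in> measurable (data_space m d) (euclid d)"
    and C: "0 < C" and N0: "0 < N 0" and L: "0 < L" "L\<^sup>2 = \<tau>\<^sup>2 / real (N 0)"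
    and s: "\<And>k. k \<in> {1..m} \<Longrightarrow> s k \<in> extensional {..<d}"
    and h: "\<And>k. k \<in> {1..m} \<Longrightarrow> dist2 d (s k) (corner d (L / 2) T) \<le> h k"
  shows "ennreal (min C 1) * (\<integral>\<^sup>+x. ennreal ((dist2 d (est (with_target m d s x))
      (corner d (L / 2) T))\<^sup>2) \<partial>coins d L T)
    \<le> worst_risk C m d N \<tau> est h"
proof -
  let ?v = "corner d (L / 2) T" and ?q = "contaminated d (min C 1) L T"
  let ?P = "fixed_source_law m d s ?q" and ?\<theta> = "with_target m d s ?v"
  have \<theta>0: "?\<theta> 0 = ?v" by (simp add: with_target_def corner_def)
  have comp: "compatible C m d N \<tau> h ?P ?\<theta>"
  proof (rule fixed_source_law_compatible[OF s corner_extensional])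
    show "dist2 d (s k) ?v \<le> h k" if "k \<in> {1..m}" for k by (rule h[OF that])
    fix t a assume t: "0 < (t :: real)" and a: "L2_set a {..<d} = 1"
    have "measure_pmf.prob ?q {x. t < (\<Sum>i<d. a i * (x i - ?v i))} \<le> min C 1 * exp (- (t\<^sup>2 / (2 * L\<^sup>2)))"
      using C by (intro contaminated_tail L(1) t a) auto
    also have "\<dots> \<le> C * exp (- (t\<^sup>2 / (2 * L\<^sup>2)))" by (intro mult_right_mono) auto
    also have "t\<^sup>2 / (2 * L\<^sup>2) = real (N 0) * t\<^sup>2 / (2 * \<tau>\<^sup>2)" using N0 by (simp add: L)
    finally show "measure_pmf.prob ?q {x. t < (\<Sum>i<d. a i * (x i - ?v i))}
        \<le> C * exp (- (real (N 0) * t\<^sup>2 / (2 * \<tau>\<^sup>2)))" .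
  qed (use C in auto)
  have "prob_space ?P" unfolding fixed_source_law_def
    by (rule measure_pmf.prob_space_distr) (rule measurable_with_target[OF s])
  then have cls: "?P \<in> dist_class C m d N \<tau> h"
    using comp fixed_source_law_indep[OF s] by (auto simp: dist_class_def fixed_source_law_def)
  have "(\<lambda>\<omega>. dist2 d (est \<omega>) ?v) \<in> borel_measurable (data_space m d)"
    by (intro borel_measurable_dist2 est measurable_const) (simp add: space_euclid corner_extensional)
  then have meas: "(\<lambda>\<omega>. ennreal ((dist2 d (est \<omega>) ?v)\<^sup>2)) \<in> borel_measurable (data_space m d)"
    by (intro measurable_compose[OF _ measurable_ennreal] borel_measurable_power)
  have "ennreal (min C 1) * (\<integral>\<^sup>+x. ennreal ((dist2 d (est (with_target m d s x)) ?v)\<^sup>2) \<partial>coins d L T)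
      \<le> (\<integral>\<^sup>+x. ennreal ((dist2 d (est (with_target m d s x)) ?v)\<^sup>2) \<partial>?q)"
    using C by (intro contaminated_nn_integral_ge) auto
  also have "\<dots> = (\<integral>\<^sup>+\<omega>. ennreal ((dist2 d (est \<omega>) (?\<theta> 0))\<^sup>2) \<partial>?P)"
    unfolding \<theta>0 fixed_source_law_def
    by (rule nn_integral_distr[symmetric, OF measurable_with_target[OF s]]) (use meas in simp_all)
  also have "\<dots> \<le> worst_risk C m d N \<tau> est h"
    unfolding worst_risk_def using comp by (intro SUP_upper2[OF cls] SUP_upper2[of ?\<theta>]) auto
  finally show ?thesis .
qed

lemma dist2_corner_flip:
  assumes "i < d" "0 \<le> \<delta>"
  shows "dist2 d (corner d \<delta> T) (corner d \<delta> (flip i T)) = 2 * \<delta>"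
proof -
  have "(\<Sum>j<d. (corner d \<delta> T j - corner d \<delta> (flip i T) j)\<^sup>2) = (\<Sum>j<d. if j = i then (2 * \<delta>)\<^sup>2 else 0)"
    by (intro sum.cong) (auto simp: corner_def mem_flip power2_eq_square)
  also have "\<dots> = (2 * \<delta>)\<^sup>2" using assms(1) by simp
  finally show ?thesis
    unfolding dist2_def L2_set_def using assms(2) by (simp only: real_sqrt_abs abs_of_nonneg mult_nonneg_nonneg zero_le_numeral)
qed

text \<open>
  With all biases up to one the sources may carry no information: they all equal \<open>0\<close>, and because
  of \<open>d \<tau>\<^sup>2 / n\<^sub>0 \<le> 1\<close> the cube with side length \<open>L = \<tau> / sqrt n\<^sub>0\<close> has all its corners within
  distance one of \<open>0\<close>. The target has to be estimated from its own data.
\<close>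
lemma worst_risk_full_bias:
  assumes est: "est \<in> measurable (data_space m d) (euclid d)"
    and C: "0 < C" and \<tau>: "0 < \<tau>" and N0: "0 < N 0" and small: "real d * \<tau>\<^sup>2 / real (N 0) \<le> 1"
  shows "ennreal (min C 1 * (real d * \<tau>\<^sup>2 / real (N 0)) / 2)
    \<le> 6 * worst_risk C m d N \<tau> est (\<lambda>k\<in>{1..m}. 1)"
proof -
  define L where "L = \<tau> / sqrt (real (N 0))"
  have L: "L > 0" "L\<^sup>2 = \<tau>\<^sup>2 / real (N 0)" using \<tau> N0 by (simp_all add: L_def power_divide)
  define W where "W = worst_risk C m d N \<tau> est (\<lambda>k\<in>{1..m}. 1)"
  define s :: "nat \<Rightarrow> nat \<Rightarrow> real" where "s k = (\<lambda>i\<in>{..<d}. 0)" for k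
  define F where "F T = (\<integral>\<^sup>+x. ennreal ((dist2 d (est (with_target m d s x)) (corner d (L / 2) T))\<^sup>2) \<partial>coins d L T)" for T
  have risk: "ennreal (min C 1) * F T \<le> W" for T
    unfolding F_def W_def
  proof (rule worst_risk_ge_coins_risk[where N = N, OF est C N0 L])
    fix k assume k: "k \<in> {1..m}"
    show "s k \<in> extensional {..<d}" by (simp add: s_def)
    have "(dist2 d (s k) (corner d (L / 2) T))\<^sup>2 = real d * (L\<^sup>2 / 4)"
      unfolding dist2_square
      by (subst sum.cong[where h = "\<lambda>_. L\<^sup>2 / 4", OF refl]) (auto simp: s_def corner_def power2_eq_square)
    also have "\<dots> = real d * \<tau>\<^sup>2 / real (N 0) / 4" by (simp add: L(2))
    also have "\<dots> \<le> 1\<^sup>2"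
    proof -
      have "x / 4 \<le> 1\<^sup>2" if "x \<le> 1" for x :: real using that by simp
      from this[OF small] show ?thesis .
    qed
    finally have "dist2 d (s k) (corner d (L / 2) T) \<le> 1" by (rule power2_le_imp_le) simp
    then show "dist2 d (s k) (corner d (L / 2) T) \<le> (\<lambda>k\<in>{1..m}. 1) k"
      using k by simp
  qed
  have "ennreal (2 ^ d) * ennreal (min C 1 * (real d * L\<^sup>2) / 2) = ennreal (min C 1) * ennreal (2 ^ d * (real d * L\<^sup>2 / 2))"
    using C by (simp add: ennreal_mult[symmetric] mult_ac)
  also have "\<dots> \<le> ennreal (min C 1) * (6 * (\<Sum>T\<in>Pow {..<d}. F T))"
    unfolding F_def by (intro mult_left_mono average_risk L(1)) auto
  also have "\<dots> = 6 * (\<Sum>T\<in>Pow {..<d}. ennreal (min C 1) * F T)"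
    by (simp add: sum_distrib_left mult_ac)
  also have "\<dots> \<le> 6 * (\<Sum>T\<in>Pow {..<d}. W)" by (intro mult_left_mono sum_mono risk) auto
  also have "\<dots> = ennreal (2 ^ d) * (6 * W)"
    by (simp add: card_Pow ennreal_power[symmetric] mult_ac)
  finally have "ennreal (2 ^ d) * ennreal (min C 1 * (real d * L\<^sup>2) / 2) \<le> ennreal (2 ^ d) * (6 * W)" .
  then have "ennreal (min C 1 * (real d * L\<^sup>2) / 2) \<le> 6 * W"
    by (subst (asm) ennreal_mult_le_mult_iff) auto
  then show ?thesis by (simp add: W_def L)
qed

text \<open>
  This is the price of not knowing which source is unbiased. Sources 1 and 2 sit at two corners at
  distance \<open>L = \<tau> / sqrt n\<^sub>0\<close>, and the target is at one of the two. The sources are identical in both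
  cases, so only one coordinate of the target data tells the two cases apart.
\<close>
lemma worst_risk_one_unbiased_source:
  assumes est: "est \<in> measurable (data_space m d) (euclid d)"
    and C: "0 < C" and \<tau>: "0 < \<tau>" and N0: "0 < N 0" and d: "0 < d"
    and small: "real d * \<tau>\<^sup>2 / real (N 0) \<le> 1"
  shows "ennreal (min C 1 * (\<tau>\<^sup>2 / real (N 0)) / 2)
    \<le> 3 * (worst_risk C m d N \<tau> est (\<lambda>k\<in>{1..m}. if k = 1 then 0 else 1)
        + worst_risk C m d N \<tau> est (\<lambda>k\<in>{1..m}. if k = 2 then 0 else 1))"
proof -
  define L where "L = \<tau> / sqrt (real (N 0))"
  have L: "L > 0" "L\<^sup>2 = \<tau>\<^sup>2 / real (N 0)" using \<tau> N0 by (simp_all add: L_def power_divide)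
  have L1: "L \<le> 1"
  proof -
    have "1 * L\<^sup>2 \<le> real d * L\<^sup>2" using d by (intro mult_right_mono) auto
    then have "L\<^sup>2 \<le> 1\<^sup>2" using small L by simp
    then show ?thesis by (rule power2_le_imp_le) simp
  qed
  let ?p = "min C 1" and ?T = "{} :: nat set" and ?T' = "flip 0 {}"
  let ?v = "corner d (L / 2) ?T" and ?v' = "corner d (L / 2) ?T'"
  \<comment> \<open>A target at \<open>?v\<close> makes source 1 exact, a target at \<open>?v'\<close> makes source 2 exact.\<close>
  define s where "s k = (if k = 2 then ?v' else ?v)" for k :: nat
  have sext: "s k \<in> extensional {..<d}" for k by (simp add: s_def corner_extensional)
  have vv: "dist2 d ?v ?v' = L" "dist2 d ?v' ?v = L"
    using dist2_corner_flip[OF d, of "L / 2" ?T] L by (simp_all add: dist2_sym)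
  have vs: "dist2 d x x = 0" for x by (simp add: dist2_def L2_set_def)
  define g where "g x = est (with_target m d s x)" for x
  define hA where "hA = (\<lambda>k\<in>{1..m}. if k = 1 then 0 else 1 :: real)"
  define hB where "hB = (\<lambda>k\<in>{1..m}. if k = 2 then 0 else 1 :: real)"
  have A: "ennreal ?p * (\<integral>\<^sup>+x. ennreal ((dist2 d (g x) ?v)\<^sup>2) \<partial>coins d L ?T) \<le> worst_risk C m d N \<tau> est hA"
    unfolding g_def
    by (rule worst_risk_ge_coins_risk[where N = N, OF est C N0 L sext])
      (use vv vs L1 in \<open>auto simp: hA_def s_def\<close>)
  have B: "ennreal ?p * (\<integral>\<^sup>+x. ennreal ((dist2 d (g x) ?v')\<^sup>2) \<partial>coins d L ?T') \<le> worst_risk C m d N \<tau> est hB"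
    unfolding g_def
    by (rule worst_risk_ge_coins_risk[where N = N, OF est C N0 L sext])
      (use vv vs L1 in \<open>auto simp: hB_def s_def\<close>)
  have coord: "(\<integral>\<^sup>+x. ennreal ((g x 0 - y 0)\<^sup>2) \<partial>coins d L S) \<le> (\<integral>\<^sup>+x. ennreal ((dist2 d (g x) y)\<^sup>2) \<partial>coins d L S)" for y S
    unfolding dist2_square
    by (intro nn_integral_mono ennreal_leI member_le_sum[of 0 "{..<d}" "\<lambda>i. (g _ i - y i)\<^sup>2"]) (use d in auto)
  have "ennreal (?p * L\<^sup>2 / 2) = ennreal ?p * ennreal (L\<^sup>2 / 2)"
    using C by (simp add: ennreal_mult[symmetric])
  also have "\<dots> \<le> ennreal ?p * (3 * ((\<integral>\<^sup>+x. ennreal ((g x 0 - ?v 0)\<^sup>2) \<partial>coins d L ?T)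
      + (\<integral>\<^sup>+x. ennreal ((g x 0 - ?v' 0)\<^sup>2) \<partial>coins d L ?T')))"
    by (intro mult_left_mono coordinate_pair_risk[OF L(1) d]) auto
  also have "\<dots> \<le> ennreal ?p * (3 * ((\<integral>\<^sup>+x. ennreal ((dist2 d (g x) ?v)\<^sup>2) \<partial>coins d L ?T)
      + (\<integral>\<^sup>+x. ennreal ((dist2 d (g x) ?v')\<^sup>2) \<partial>coins d L ?T')))"
    by (intro mult_left_mono add_mono coord) auto
  also have "\<dots> = 3 * (ennreal ?p * (\<integral>\<^sup>+x. ennreal ((dist2 d (g x) ?v)\<^sup>2) \<partial>coins d L ?T)
      + ennreal ?p * (\<integral>\<^sup>+x. ennreal ((dist2 d (g x) ?v')\<^sup>2) \<partial>coins d L ?T'))"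
    by (simp only: distrib_left mult.left_commute)
  also have "\<dots> \<le> 3 * (worst_risk C m d N \<tau> est hA + worst_risk C m d N \<tau> est hB)"
    by (intro mult_left_mono add_mono A B) auto
  finally show ?thesis by (simp add: L hA_def hB_def)
qed

section \<open>Matching bounds on the intrinsic cost of adaptation\<close>

lemma worst_risk_le_adaptation_cost:
  assumes "h \<in> H" and pos: "0 < oracle_rate m d N \<tau> h" and R: "oracle_rate m d N \<tau> h \<le> r"
  shows "worst_risk C m d N \<tau> est h \<le> ennreal r * adaptation_cost C m d N \<tau> est H"
proof -
  let ?W = "worst_risk C m d N \<tau> est h"
  let ?R = "ennreal (oracle_rate m d N \<tau> h)"
  have "?W = ?R * (?W / ?R)"
    using pos by (simp add: ennreal_times_divide ennreal_mult_divide_eq mult.commute[of ?R])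
  also have "\<dots> \<le> ennreal r * adaptation_cost C m d N \<tau> est H"
    unfolding adaptation_cost_def by (intro mult_mono ennreal_leI R SUP_upper[OF assms(1)]) auto
  finally show ?thesis .
qed

lemma ennreal_le_of_scaled:
  assumes "ennreal (c * r) \<le> ennreal r * x" "0 < r" "0 \<le> c"
  shows "ennreal c \<le> x"
proof -
  have "ennreal r * ennreal c \<le> ennreal r * x"
    using assms by (simp add: ennreal_mult[symmetric] mult.commute)
  then show ?thesis by (subst (asm) ennreal_mult_le_mult_iff) (use assms(2) in auto)
qed

text \<open>
  Both terms of the maximum come from a bias vector with a small oracle rate: all biases equal to one
  give \<open>1\<close>, since the oracle rate is then at most \<open>d \<tau>\<^sup>2 / n\<^sub>0\<close> and no estimator has a smaller order
  of risk; a single unbiased source lets the oracle reach \<open>d \<tau>\<^sup>2 / (n\<^sub>0 + n)\<close>, while the estimator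
  has to pay \<open>\<tau>\<^sup>2 / n\<^sub>0\<close> to find it.
\<close>
theorem adaptation_cost_lower_bound:
  assumes est: "est \<in> measurable (data_space m d) (euclid d)"
    and C: "0 < C" and \<tau>: "0 < \<tau>" and N0: "0 < N 0" and d: "0 < d" and n: "0 < n" and m: "2 \<le> m"
    and N: "\<forall>k\<in>{1..m}. N k = n"
    and small: "real d * \<tau>\<^sup>2 / real (N 0) \<le> 1"
  shows "ennreal (min C 1 / 12 * max (real n / (real d * real (N 0))) 1)
    \<le> adaptation_cost C m d N \<tau> est (bias_cube m)"
proof -
  let ?p = "min C 1" and ?n0 = "real (N 0)"
  have Npos: "0 < N k" if "k \<in> {0..m}" for k using that N N0 n by (cases "k = 0") auto
  note pos = oracle_rate_pos[where N = N, OF d \<tau> Npos]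
  define A where "A = adaptation_cost C m d N \<tau> est (bias_cube m)"
  have "ennreal (?p / 12) \<le> A"
  proof -
    define r where "r = real d * \<tau>\<^sup>2 / ?n0"
    have r: "0 < r" using d \<tau> N0 by (simp add: r_def)
    have R: "oracle_rate m d N \<tau> (\<lambda>k\<in>{1..m}. 1) \<le> r"
      using oracle_rate_le[of "{0}" m d N \<tau> "\<lambda>k\<in>{1..m}. 1"] by (simp add: r_def)
    have "ennreal (?p * r / 2) \<le> 6 * worst_risk C m d N \<tau> est (\<lambda>k\<in>{1..m}. 1)"
      unfolding r_def by (rule worst_risk_full_bias[where N = N, OF est C \<tau> N0 small])
    also have "\<dots> \<le> 6 * (ennreal r * A)"
      unfolding A_def by (intro mult_left_mono worst_risk_le_adaptation_cost pos R) (auto simp: bias_cube_def)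
    also have "\<dots> = ennreal (6 * r) * A" using r by (simp add: ennreal_mult mult.assoc)
    finally have "ennreal (?p / 12 * (6 * r)) \<le> ennreal (6 * r) * A" by (simp add: mult.commute)
    then show ?thesis by (rule ennreal_le_of_scaled) (use r C in auto)
  qed
  moreover have "ennreal (?p / 12 * (real n / (real d * ?n0))) \<le> A"
  proof -
    define r where "r = real d * \<tau>\<^sup>2 / (?n0 + real n)"
    have r: "0 < r" using d \<tau> N0 by (simp add: r_def)
    have R: "oracle_rate m d N \<tau> (\<lambda>k\<in>{1..m}. if k = j then 0 else 1) \<le> r" if j: "j \<in> {1..m}" for j
      using oracle_rate_le[of "{0, j}" m d N \<tau> "\<lambda>k\<in>{1..m}. if k = j then 0 else 1"] j N by (simp add: r_def)
    have W: "worst_risk C m d N \<tau> est (\<lambda>k\<in>{1..m}. if k = j then 0 else 1) \<le> ennreal r * A" if "j \<in> {1..m}" for j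
      unfolding A_def by (intro worst_risk_le_adaptation_cost pos R that) (auto simp: bias_cube_def)
    have "real n / (real d * ?n0) * r \<le> \<tau>\<^sup>2 / ?n0"
    proof -
      have "real n / (real d * ?n0) * r = real n / (?n0 + real n) * (\<tau>\<^sup>2 / ?n0)"
        using d by (simp add: r_def)
      also have "\<dots> \<le> 1 * (\<tau>\<^sup>2 / ?n0)" using N0 by (intro mult_right_mono) (auto simp: field_simps)
      finally show ?thesis by simp
    qed
    then have "?p / 2 * (real n / (real d * ?n0) * r) \<le> ?p / 2 * (\<tau>\<^sup>2 / ?n0)"
      using C by (intro mult_left_mono) auto
    then have "ennreal (?p / 12 * (real n / (real d * ?n0)) * (6 * r)) \<le> ennreal (?p * (\<tau>\<^sup>2 / ?n0) / 2)"
      by (intro ennreal_leI) (simp add: mult_ac)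
    also have "\<dots> \<le> 3 * (worst_risk C m d N \<tau> est (\<lambda>k\<in>{1..m}. if k = 1 then 0 else 1)
        + worst_risk C m d N \<tau> est (\<lambda>k\<in>{1..m}. if k = 2 then 0 else 1))"
      by (rule worst_risk_one_unbiased_source[where N = N, OF est C \<tau> N0 d small])
    also have "\<dots> \<le> 3 * (ennreal r * A + ennreal r * A)"
      using m by (intro mult_left_mono add_mono W) auto
    also have "\<dots> = ennreal (6 * r) * A"
      using r by (simp add: ennreal_mult mult_2[symmetric] mult.assoc[symmetric])
    finally show ?thesis by (rule ennreal_le_of_scaled) (use r C in auto)
  qed
  ultimately show ?thesis
    unfolding A_def
    by (cases "real n / (real d * ?n0) \<le> 1") (simp_all only: max_def if_True if_False mult_1_right)
qed

theorem theorem6: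
  fixes m :: nat and C :: real
  assumes "m \<ge> 2" and "C > 0"
  shows "\<exists>cL cU :: real. cL > 0 \<and> cU > 0 \<and>
    (\<forall>(d :: nat) (n :: nat) (n0 :: nat) (N :: nat \<Rightarrow> nat) (\<tau> :: real).
       d \<ge> 1 \<longrightarrow> n \<ge> 1 \<longrightarrow> n0 \<ge> 1 \<longrightarrow> \<tau> > 0 \<longrightarrow> real d * \<tau>\<^sup>2 / real n0 \<le> 1 \<longrightarrow>
       N 0 = n0 \<longrightarrow> (\<forall>k\<in>{1..m}. N k = n) \<longrightarrow>
         ennreal (cL * max (real n / (real d * real n0)) 1)
           \<le> intrinsic_cost C m d N \<tau> (bias_cube m) \<and>
         intrinsic_cost C m d N \<tau> (bias_cube m)
           \<le> ennreal (cU * max (real n / (real d * real n0)) 1))"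
proof (rule exI[of _ "min C 1 / 12"], rule exI[of _ "144 * (3 + 2 * C) * (real m + 1)\<^sup>2"],
    intro conjI allI impI)
  show "0 < min C 1 / 12" using assms by simp
  show "0 < 144 * (3 + 2 * C) * (real m + 1)\<^sup>2" using assms by simp
  fix d n n0 :: nat and N :: "nat \<Rightarrow> nat" and \<tau> :: real
  assume d: "d \<ge> 1" and n: "n \<ge> 1" and n0: "n0 \<ge> 1" and \<tau>: "\<tau> > 0"
    and small: "real d * \<tau>\<^sup>2 / real n0 \<le> 1" and N0: "N 0 = n0" and N: "\<forall>k\<in>{1..m}. N k = n"
  show "ennreal (min C 1 / 12 * max (real n / (real d * real n0)) 1)
      \<le> intrinsic_cost C m d N \<tau> (bias_cube m)"
    unfolding intrinsic_cost_def N0[symmetric]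
    by (intro INF_greatest adaptation_cost_lower_bound) (use assms d n n0 \<tau> small N0 N in auto)
  show "intrinsic_cost C m d N \<tau> (bias_cube m)
      \<le> ennreal (144 * (3 + 2 * C) * (real m + 1)\<^sup>2 * max (real n / (real d * real n0)) 1)"
    unfolding N0[symmetric]
    by (rule intrinsic_cost_upper_bound) (use assms d n n0 \<tau> N0 N in auto)
qed

end
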